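(* Let $Y$ be a quotient of the Schreier space $S$. Then $Y$ has property-$S(1)$: every normalized weakly null sequence in $Y$ admits a block basis of 1-averages which is equivalent to the unit vector basis of $c_0$.
   Context: Let $c_{00}$ be the space of finitely supported real sequences. For $x=(x_i)\in c_{00}$ set $\|x\|=\max\{\sum_{i=1}^p |x_{k_i}| : p\in\mathbb{N},\ p\le k_1<k_2<\cdots<k_p\}$. The Schreier space $S$ is the completion of $(c_{00},\|\cdot\|)$. $Y$ is a quotient of $S$ if there is a bounded linear operator from $S$ onto $Y$. Given a sequence $(x_n)$, a 1-average of $(x_n)$ is a vector $\lambda\sum_{n\in F}x_n$ with $\lambda>0$ and $F$ a finite nonempty subset of $\mathbb{N}$; a block basis of 1-averages of $(x_n)$ is a sequence $(\lambda_k\sum_{n\in F_k}x_n)_k$ of 1-averages with $\max F_k<\min F_{k+1}$ for all $k$. *)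

theory Defs
  imports "HOL-Analysis.Analysis"
begin

text \<open>Sequences are indexed from 0 in Isabelle: coordinate i of x :: nat => real
  is the paper's coordinate x_(i+1).  A finite nonempty set F of (0-based) indices
  is Schreier-admissible iff card F <= min F + 1 (paper: p <= k_1).\<close>

definition schreier_admissible :: "nat set \<Rightarrow> bool" where
  "schreier_admissible F \<longleftrightarrow> finite F \<and> F \<noteq> {} \<and> card F \<le> Min F + 1"

definition schreier_norm :: "(nat \<Rightarrow> real) \<Rightarrow> real" where
  "schreier_norm x = Sup {(\<Sum>i\<in>F. \<bar>x i\<bar>) | F. schreier_admissible F}"

definition finitely_supported :: "(nat \<Rightarrow> real) \<Rightarrow> bool" where
  "finitely_supported y \<longleftrightarrow> finite {i. y i \<noteq> 0}"

text \<open>The Schreier space S: the completion of c00 under the Schreier norm, realised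
  concretely as the sequences of bounded Schreier norm that are Schreier-norm limits
  of finitely supported sequences.\<close>

definition schreier_space :: "(nat \<Rightarrow> real) set" where
  "schreier_space = {x. bdd_above {(\<Sum>i\<in>F. \<bar>x i\<bar>) | F. schreier_admissible F} \<and>
      (\<forall>e>0. \<exists>y. finitely_supported y \<and> schreier_norm (\<lambda>i. x i - y i) < e)}"

definition schreier_quotient_map :: "((nat \<Rightarrow> real) \<Rightarrow> 'b::real_normed_vector) \<Rightarrow> bool" where
  "schreier_quotient_map T \<longleftrightarrow>
     (\<forall>x\<in>schreier_space. \<forall>y\<in>schreier_space. \<forall>a b.
        T (\<lambda>i. a * x i + b * y i) = a *\<^sub>R T x + b *\<^sub>R T y) \<and>
     (\<exists>C. \<forall>x\<in>schreier_space. norm (T x) \<le> C * schreier_norm x) \<and>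
     T ` schreier_space = UNIV"

definition weakly_null :: "(nat \<Rightarrow> 'b::real_normed_vector) \<Rightarrow> bool" where
  "weakly_null x \<longleftrightarrow> (\<forall>f :: 'b \<Rightarrow> real. bounded_linear f \<longrightarrow> (\<lambda>n. f (x n)) \<longlonglongrightarrow> 0)"

definition block_basis_of_1_averages :: "(nat \<Rightarrow> 'b::real_normed_vector) \<Rightarrow> (nat \<Rightarrow> 'b) \<Rightarrow> bool" where
  "block_basis_of_1_averages x y \<longleftrightarrow>
     (\<exists>(lam :: nat \<Rightarrow> real) (F :: nat \<Rightarrow> nat set).
        (\<forall>k. lam k > 0 \<and> finite (F k) \<and> F k \<noteq> {} \<and> Max (F k) < Min (F (Suc k))) \<and>
        (\<forall>k. y k = lam k *\<^sub>R (\<Sum>n\<in>F k. x n)))"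

definition equivalent_to_c0_basis :: "(nat \<Rightarrow> 'b::real_normed_vector) \<Rightarrow> bool" where
  "equivalent_to_c0_basis y \<longleftrightarrow>
     (\<exists>A B. A > 0 \<and> B > 0 \<and>
        (\<forall>(a :: nat \<Rightarrow> real) n.
           A * Max ((\<lambda>k. \<bar>a k\<bar>) ` {..n}) \<le> norm (\<Sum>k\<le>n. a k *\<^sub>R y k) \<and>
           norm (\<Sum>k\<le>n. a k *\<^sub>R y k) \<le> B * Max ((\<lambda>k. \<bar>a k\<bar>) ` {..n})))"

end

theory Submission
  imports Defs
begin

text \<open>
  A sequence in the Schreier space that is bounded and whose sup norms decrease fast enough satisfies
  an upper \<open>c\<^sub>0\<close> estimate. So it suffices to find blocks of 1-averages of \<open>(x n)\<close>, bounded below in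
  norm, that have bounded lifts with sup norms tending to zero; a lower estimate then holds for a
  subsequence, because the blocks are weakly null.

  If the sums of the \<open>x n\<close> over finite sets are bounded on a tail, then \<open>(x n)\<close> itself satisfies an
  upper \<open>c\<^sub>0\<close> estimate. Otherwise take a finite set \<open>F\<close> for which \<open>\<Sum>n\<in>F. x n\<close> has huge norm \<open>1/c\<close>, and a
  bounded lift \<open>u\<close> of \<open>c *\<^sub>R (\<Sum>n\<in>F. x n)\<close>. Along a suitable subsequence, \<open>u\<close> splits by a partition of
  unity on the coordinates into lifts of the individual \<open>c *\<^sub>R x n\<close>, where each coordinate belongs to at
  most two of them (a form of Odell's argument for quotients of spaces with shrinking unconditional
  bases). By definition of the Schreier norm only few coordinates of \<open>u\<close> exceed a given \<open>\<delta>\<close>. Deleting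
  the few indices \<open>n\<close> touched by them costs little, since \<open>c\<close> is small, and leaves a lift with
  sup norm at most \<open>\<delta>\<close>.

  Lifts are only needed approximately, so only finitely supported sequences occur and Baire's
  theorem replaces the open mapping theorem.
\<close>

subsection \<open>The Hahn-Banach theorem\<close>

text \<open>The obstacle is that a lift of a sum does not show which of its coordinates belong to
  which summand. Cutting the lift inside a gap recovers the lower partial sum only if the far part
  of the sum is almost invisible to each functional, and weak nullness says nothing about sums of
  many terms. Since the Schreier basis is shrinking, the dual of the range is separable, and a
  diagonal subsequence makes all far sums of bounded norm uniformly small on each functional. A
  second subsequence then leaves gaps that are long enough for cutting. Weights between 0 and 1 do
  not increase the Schreier norm, so lifts of the retained sums obey the same bound as the original
  lift. This unconditionality lets summands be discarded freely. Flatness yields the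
  \<open>c0\<close> estimate because an admissible set whose minimum lies below the support bound of
  an early vector has few elements, and so collects little from the later, much flatter
  vectors.\<close>

definition sublinear :: "('a::real_vector \<Rightarrow> real) \<Rightarrow> bool" where
  "sublinear p \<longleftrightarrow> (\<forall>x y. p (x + y) \<le> p x + p y) \<and> (\<forall>c x. 0 \<le> c \<longrightarrow> p (c *\<^sub>R x) = c * p x)"

lemma sublinear_add: "sublinear p \<Longrightarrow> p (x + y) \<le> p x + p y"
  by (simp add: sublinear_def)

lemma sublinear_scale: "sublinear p \<Longrightarrow> 0 \<le> c \<Longrightarrow> p (c *\<^sub>R x) = c * p x"
  by (simp add: sublinear_def)

lemma sublinear_zero: "sublinear p \<Longrightarrow> p 0 = 0"
  using sublinear_scale[of p 0 0] by simp

lemma sublinear_neg: "sublinear p \<Longrightarrow> - p (- x) \<le> p x"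
  using sublinear_add[of p x "- x"] sublinear_zero[of p] by simp

text \<open>Subadditivity of the infimum uses the chain condition: near-minimizers for
  \<open>x\<close> and for \<open>y\<close> can be replaced by the smaller of the two. The infimum
  is finite because \<open>- p (- x) \<le> - q (- x) \<le> q x\<close>. This provides the bounds of
  chains for Zorn's lemma.\<close>

lemma sublinear_cINF_chain:
  fixes C :: "('a::real_vector \<Rightarrow> real) set"
  assumes "C \<noteq> {}" and sub: "\<And>q. q \<in> C \<Longrightarrow> sublinear q \<and> q \<le> p"
    and chain: "\<And>q r. q \<in> C \<Longrightarrow> r \<in> C \<Longrightarrow> q \<le> r \<or> r \<le> q"
    and "sublinear p"
  shows "sublinear (\<lambda>x. INF q\<in>C. q x)" "\<And>q x. q \<in> C \<Longrightarrow> (INF q\<in>C. q x) \<le> q x"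
proof -
  have bdd: "bdd_below ((\<lambda>q. q x) ` C)" for x
  proof (rule bdd_belowI2)
    fix q assume "q \<in> C"
    then show "- p (- x) \<le> q x"
      using sublinear_neg[of q x] sub[of q] le_funD[of q p "- x"] by linarith
  qed
  show le: "(INF q\<in>C. q x) \<le> q x" if "q \<in> C" for q x
    using that by (intro cINF_lower bdd)
  let ?i = "\<lambda>x. INF q\<in>C. q x"
  have "?i (x + y) \<le> ?i x + ?i y" for x y
  proof (rule field_le_epsilon)
    fix e :: real assume "e > 0"
    obtain q where q: "q \<in> C" "q x < ?i x + e / 2"
      using cInf_lessD[of "(\<lambda>q. q x) ` C" "?i x + e / 2"] assms(1) \<open>e > 0\<close> by auto
    obtain r where r: "r \<in> C" "r y < ?i y + e / 2"
      using cInf_lessD[of "(\<lambda>q. q y) ` C" "?i y + e / 2"] assms(1) \<open>e > 0\<close> by auto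
    obtain s where s: "s \<in> C" "s x \<le> q x" "s y \<le> r y"
      using chain[OF q(1) r(1)] q r by (auto simp: le_fun_def)
    have "?i (x + y) \<le> s (x + y)" using le s by blast
    also have "\<dots> \<le> s x + s y" using sub s by (simp add: sublinear_add)
    finally show "?i (x + y) \<le> ?i x + ?i y + e" using s q r by linarith
  qed
  moreover have "?i (c *\<^sub>R x) = c * ?i x" if "0 \<le> c" for c x
  proof (cases "c = 0")
    case True
    have "(\<lambda>q. q 0) ` C = {0}" using assms(1) sub sublinear_zero by force
    with True show ?thesis by (metis cInf_singleton mult_zero_left scaleR_zero_left)
  next
    case False
    with that have c: "c > 0" by simp
    have 1: "b * ?i x \<le> ?i (b *\<^sub>R x)" if "b > 0" for b x
    proof (rule cINF_greatest[OF assms(1)])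
      fix q assume "q \<in> C"
      then show "b * ?i x \<le> q (b *\<^sub>R x)"
        using sub[of q] that le[of q x] by (simp add: sublinear_scale)
    qed
    have "inverse c * ?i (c *\<^sub>R x) \<le> ?i (inverse c *\<^sub>R c *\<^sub>R x)" using c by (intro 1) auto
    then have "?i (c *\<^sub>R x) \<le> c * ?i x" using c by (simp add: field_simps)
    with 1[OF c, of x] show ?thesis by simp
  qed
  ultimately show "sublinear ?i" by (simp add: sublinear_def)
qed

text \<open>A minimal sublinear functional equals all of these infima and is therefore additive.\<close>

lemma sublinear_directional:
  fixes q :: "'a::real_vector \<Rightarrow> real"
  assumes q: "sublinear q"
  defines "r \<equiv> \<lambda>a y. INF t\<in>{0..}. q (y + t *\<^sub>R a) - t * q a"
  shows "sublinear (r a)" "r a \<le> q" "r a y \<le> q (y + a) - q a"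
proof -
  have bdd: "bdd_below ((\<lambda>t. q (y + t *\<^sub>R a) - t * q a) ` {0..})" for y
  proof (rule bdd_belowI2)
    fix t :: real assume "t \<in> {0..}"
    \<comment> \<open>Subadditivity for the decomposition of \<open>t *\<^sub>R a\<close> into
      \<open>y + t *\<^sub>R a\<close> and \<open>- y\<close>.\<close>
    then have "t * q a \<le> q (y + t *\<^sub>R a) + q (- y)"
      using sublinear_add[OF q, of "y + t *\<^sub>R a" "- y"] sublinear_scale[OF q, of t a] by simp
    then show "- q (- y) \<le> q (y + t *\<^sub>R a) - t * q a" by simp
  qed
  have le: "r a y \<le> q (y + t *\<^sub>R a) - t * q a" if "0 \<le> t" for t y
    unfolding r_def using that by (intro cINF_lower bdd) auto
  show "r a \<le> q" using le[of 0] by (simp add: le_fun_def)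
  show "r a y \<le> q (y + a) - q a" using le[of 1 y] by simp
  have ex: "\<exists>t\<ge>0. q (y + t *\<^sub>R a) - t * q a < r a y + e" if "e > 0" for y e
    using cInf_lessD[of "(\<lambda>t. q (y + t *\<^sub>R a) - t * q a) ` {0..}" "r a y + e"] that
    unfolding r_def by auto
  have "r a (x + y) \<le> r a x + r a y" for x y
  proof (rule field_le_epsilon)
    fix e :: real assume "e > 0"
    then obtain s t where st: "s \<ge> 0" "q (x + s *\<^sub>R a) - s * q a < r a x + e / 2"
      "t \<ge> 0" "q (y + t *\<^sub>R a) - t * q a < r a y + e / 2" using ex[of "e/2"] by (metis half_gt_zero)
    have "r a (x + y) \<le> q (x + y + (s + t) *\<^sub>R a) - (s + t) * q a" using st by (intro le) auto
    also have "x + y + (s + t) *\<^sub>R a = (x + s *\<^sub>R a) + (y + t *\<^sub>R a)" by (simp add: algebra_simps)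
    also have "q ((x + s *\<^sub>R a) + (y + t *\<^sub>R a)) - (s + t) * q a
        \<le> (q (x + s *\<^sub>R a) - s * q a) + (q (y + t *\<^sub>R a) - t * q a)"
      using sublinear_add[OF q, of "x + s *\<^sub>R a" "y + t *\<^sub>R a"] by (simp add: distrib_right)
    finally show "r a (x + y) \<le> r a x + r a y + e" using st by linarith
  qed
  moreover have "r a (c *\<^sub>R x) = c * r a x" if c0: "0 \<le> c" for c x
  proof (cases "c = 0")
    case True
    have "(\<lambda>t. q (0 + t *\<^sub>R a) - t * q a) ` {0..} = {0}" using sublinear_scale[OF q] by force
    then show ?thesis using True unfolding r_def by simp
  next
    case False
    with c0 have c: "c > 0" by simp
    \<comment> \<open>One inequality for every positive factor is enough: applied to
      \<open>inverse c\<close>, it gives the converse for \<open>c\<close>.\<close>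
    have 1: "r a (b *\<^sub>R x) \<le> b * r a x" if b: "b > 0" for b x
    proof (rule field_le_epsilon)
      fix e :: real assume "e > 0"
      then obtain t where t: "t \<ge> 0" "q (x + t *\<^sub>R a) - t * q a < r a x + e / b"
        using ex[of "e / b"] b by auto
      have "r a (b *\<^sub>R x) \<le> q (b *\<^sub>R x + (b * t) *\<^sub>R a) - (b * t) * q a" using t b by (intro le) auto
      also have "b *\<^sub>R x + (b * t) *\<^sub>R a = b *\<^sub>R (x + t *\<^sub>R a)" by (simp add: algebra_simps)
      also have "q (b *\<^sub>R (x + t *\<^sub>R a)) - (b * t) * q a = b * (q (x + t *\<^sub>R a) - t * q a)"
        using sublinear_scale[OF q, of b "x + t *\<^sub>R a"] b by (simp add: right_diff_distrib)
      also have "\<dots> \<le> b * (r a x + e / b)" using t b by (intro mult_left_mono) auto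
      finally show "r a (b *\<^sub>R x) \<le> b * r a x + e" using b by (simp add: algebra_simps)
    qed
    have "r a (inverse c *\<^sub>R c *\<^sub>R x) \<le> inverse c * r a (c *\<^sub>R x)" using c by (intro 1) auto
    then have "c * r a x \<le> r a (c *\<^sub>R x)" using c by (simp add: field_simps)
    with 1[OF c, of x] show ?thesis by simp
  qed
  ultimately show "sublinear (r a)" by (simp add: sublinear_def)
qed

theorem sublinear_dominates_linear:
  fixes p :: "'a::real_vector \<Rightarrow> real"
  assumes p: "sublinear p"
  obtains f where "linear f" "f \<le> p"
proof -
  define A where "A = {q. sublinear q \<and> q \<le> p}"
  \<comment> \<open>The order is reversed, so that a maximal element for \<open>P\<close> is a
    minimal sublinear functional.\<close>
  define P where "P = (\<lambda>q r :: 'a \<Rightarrow> real. r \<le> q)"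
  have "\<exists>m\<in>A. \<forall>a\<in>A. P m a \<longrightarrow> a = m"
  proof (rule predicate_Zorn)
    show "partial_order_on A (relation_of P A)"
      by (rule partial_order_on_relation_ofI) (auto simp: P_def)
    fix C assume "C \<in> Chains (relation_of P A)"
    then have C: "C \<subseteq> A" "\<And>q r. q \<in> C \<Longrightarrow> r \<in> C \<Longrightarrow> q \<le> r \<or> r \<le> q"
      by (auto simp: Chains_def relation_of_def P_def)
    show "\<exists>u\<in>A. \<forall>a\<in>C. P a u"
    proof (cases "C = {}")
      case True then show ?thesis using p by (auto simp: A_def)
    next
      case False
      have sub: "\<And>q. q \<in> C \<Longrightarrow> sublinear q \<and> q \<le> p" using C by (auto simp: A_def)
      have *: "sublinear (\<lambda>x. INF q\<in>C. q x)" "\<And>q x. q \<in> C \<Longrightarrow> (INF q\<in>C. q x) \<le> q x"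
        using sublinear_cINF_chain[of C p] False sub C(2) p by blast+
      obtain q where "q \<in> C" using False by auto
      have "(\<lambda>x. INF q\<in>C. q x) \<le> p"
      proof (rule le_funI)
        fix x show "(INF q\<in>C. q x) \<le> p x"
          using *(2)[OF \<open>q \<in> C\<close>, of x] sub[OF \<open>q \<in> C\<close>] le_funD[of q p x] by linarith
      qed
      with * show ?thesis
        by (intro bexI[of _ "\<lambda>x. INF q\<in>C. q x"]) (auto simp: A_def P_def le_fun_def)
    qed
  qed
  then obtain f where f_A: "f \<in> A" and f_min: "\<And>r. r \<in> A \<Longrightarrow> r \<le> f \<Longrightarrow> r = f"
    unfolding P_def by blast
  have f: "sublinear f" "f \<le> p" using f_A by (auto simp: A_def)
  have min: "r = f" if "sublinear r" "r \<le> f" for r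
    using f_min[of r] that order_trans[OF that(2) f(2)] by (simp add: A_def)
  have "f y \<le> f (y + a) - f a" for y a
  proof -
    have "(\<lambda>y. INF t\<in>{0..}. f (y + t *\<^sub>R a) - t * f a) = f"
      by (intro min sublinear_directional[OF f(1)])
    from fun_cong[OF this, of y] sublinear_directional(3)[OF f(1), of y a]
    show ?thesis by linarith
  qed
  then have add: "f (y + a) = f y + f a" for y a
    using sublinear_add[OF f(1), of y a] by (smt (verit))
  have neg: "f (- x) = - f x" for x using add[of x "- x"] sublinear_zero[OF f(1)] by simp
  have "f (c *\<^sub>R x) = c * f x" for c x
  proof (cases "c \<ge> 0")
    case True then show ?thesis using sublinear_scale[OF f(1)] by simp
  next
    case False then show ?thesis using sublinear_scale[OF f(1), of "- c" x] neg[of "c *\<^sub>R x"] by simp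
  qed
  then have "linear f" using add by (intro linearI) auto
  with f that show thesis by blast
qed

text \<open>The sublinear functional \<open>p y = inf (norm (y + t *\<^sub>R c) - t * e)\<close> is at most \<open>- e\<close>
  at \<open>- c\<close>, so a linear functional below it is at least \<open>e\<close> at \<open>c\<close>.\<close>

theorem convex_away_from_zero_separation:
  fixes C :: "'a::real_normed_vector set"
  assumes "convex C" "C \<noteq> {}" and far: "\<And>c. c \<in> C \<Longrightarrow> e \<le> norm c"
  obtains f :: "'a \<Rightarrow> real" where "bounded_linear f" "\<forall>x. \<bar>f x\<bar> \<le> norm x" "\<forall>c\<in>C. e \<le> f c"
proof -
  define D where "D = {0 :: real..} \<times> C"
  define h where "h = (\<lambda>y (t :: real, c :: 'a). norm (y + t *\<^sub>R c) - t * e)"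
  define p where "p = (\<lambda>y. INF d\<in>D. h y d)"
  have D: "D \<noteq> {}" using assms(2) by (auto simp: D_def)
  have low: "- norm y \<le> h y d" if dD: "d \<in> D" for y d
  proof -
    obtain t c where d: "d = (t, c)" "t \<ge> 0" "c \<in> C"
      using dD by (auto simp: D_def)
    have "t * e \<le> norm (t *\<^sub>R c)" using d far[of c] by (simp add: mult_left_mono)
    also have "\<dots> \<le> norm (y + t *\<^sub>R c) + norm y"
      using norm_triangle_ineq4[of "y + t *\<^sub>R c" y] by simp
    finally show ?thesis by (simp add: h_def d)
  qed
  have bdd: "bdd_below (h y ` D)" for y using low by (intro bdd_belowI2) auto
  have le: "p y \<le> h y d" if "d \<in> D" for y d unfolding p_def using that by (intro cINF_lower bdd)
  have ex: "\<exists>d\<in>D. h y d < p y + e" if "e > 0" for y e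
    using cInf_lessD[of "h y ` D" "p y + e"] that D unfolding p_def by auto
  obtain c0 where c0: "c0 \<in> C" using assms(2) by auto
  have p_norm: "p y \<le> norm y" for y using le[of "(0, c0)" y] c0 by (simp add: h_def D_def)
  have p_C: "p (- c) \<le> - e" if "c \<in> C" for c using le[of "(1, c)" "- c"] that by (simp add: h_def D_def)
  have p_add: "p (x + y) \<le> p x + p y" for x y
  proof (rule field_le_epsilon)
    fix \<epsilon> :: real assume "\<epsilon> > 0"
    then obtain d d' where dd: "d \<in> D" "h x d < p x + \<epsilon> / 2" "d' \<in> D" "h y d' < p y + \<epsilon> / 2"
      using ex by (meson half_gt_zero)
    obtain t c t' c' where d: "d = (t, c)" "t \<ge> 0" "c \<in> C" "d' = (t', c')" "t' \<ge> 0" "c' \<in> C"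
      using dd(1,3) by (auto simp: D_def)
    \<comment> \<open>By convexity the cone over \<open>C\<close> is closed under addition, so the
      two near-minimizers merge into a single competitor for \<open>x + y\<close>.\<close>
    obtain b where b: "b \<in> C" "(t + t') *\<^sub>R b = t *\<^sub>R c + t' *\<^sub>R c'"
    proof (cases "t + t' = 0")
      case True
      then have "t = 0" "t' = 0" using d by auto
      then show thesis using d that[of c] by simp
    next
      case False
      then have "(t / (t + t')) *\<^sub>R c + (t' / (t + t')) *\<^sub>R c' \<in> C"
        using d by (intro convexD[OF assms(1)]) (auto simp: add_divide_distrib[symmetric])
      moreover have "(t + t') *\<^sub>R ((t / (t + t')) *\<^sub>R c + (t' / (t + t')) *\<^sub>R c') = t *\<^sub>R c + t' *\<^sub>R c'"
        using False by (simp add: scaleR_right_distrib)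
      ultimately show thesis using that by blast
    qed
    have "p (x + y) \<le> h (x + y) (t + t', b)" using d b by (intro le) (auto simp: D_def)
    also have "h (x + y) (t + t', b) = norm ((x + t *\<^sub>R c) + (y + t' *\<^sub>R c')) - (t + t') * e"
    proof -
      have "x + y + (t + t') *\<^sub>R b = (x + t *\<^sub>R c) + (y + t' *\<^sub>R c')"
        unfolding b(2) by (simp add: add_ac)
      then show ?thesis unfolding h_def by (simp only: prod.case)
    qed
    also have "\<dots> \<le> h x d + h y d'"
      using norm_triangle_ineq[of "x + t *\<^sub>R c" "y + t' *\<^sub>R c'"] by (simp add: h_def d algebra_simps)
    finally show "p (x + y) \<le> p x + p y + \<epsilon>" using dd by linarith
  qed
  have p_le: "p (b *\<^sub>R x) \<le> b * p x" if b: "b > 0" for b x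
  proof (rule field_le_epsilon)
    fix \<epsilon> :: real assume "\<epsilon> > 0"
    then have "\<epsilon> / b > 0" using b by simp
    then obtain d where d: "d \<in> D" "h x d < p x + \<epsilon> / b" using ex by blast
    obtain t c where tc: "d = (t, c)" "t \<ge> 0" "c \<in> C"
      using d(1) by (auto simp: D_def)
    have "p (b *\<^sub>R x) \<le> h (b *\<^sub>R x) (b * t, c)" using tc b by (intro le) (auto simp: D_def)
    also have "\<dots> = norm (b *\<^sub>R (x + t *\<^sub>R c)) - b * t * e" by (simp add: h_def scaleR_right_distrib)
    also have "\<dots> = b * h x d" using b by (simp add: h_def tc right_diff_distrib)
    also have "\<dots> \<le> b * (p x + \<epsilon> / b)" using d b by (intro mult_left_mono) auto
    finally show "p (b *\<^sub>R x) \<le> b * p x + \<epsilon>" using b by (simp add: distrib_left)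
  qed
  have p0: "p 0 = 0"
  proof (rule antisym)
    show "p 0 \<le> 0" using p_norm[of 0] by simp
    show "0 \<le> p 0" unfolding p_def using D low[of _ 0] by (intro cINF_greatest) auto
  qed
  have "p (c *\<^sub>R x) = c * p x" if "0 \<le> c" for c x
  proof (cases "c = 0")
    case False
    with that have c: "c > 0" by simp
    have "p (inverse c *\<^sub>R c *\<^sub>R x) \<le> inverse c * p (c *\<^sub>R x)" using c by (intro p_le) auto
    then have "c * p x \<le> p (c *\<^sub>R x)" using c by (simp add: field_simps)
    with p_le[OF c, of x] show ?thesis by simp
  qed (simp add: p0)
  with p_add have "sublinear p" by (simp add: sublinear_def)
  then obtain f where f: "linear f" "f \<le> p" by (rule sublinear_dominates_linear)
  interpret f: linear f by fact
  have f_le: "f x \<le> norm x" for x using le_funD[OF f(2), of x] p_norm[of x] by linarith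
  have f_abs: "\<bar>f x\<bar> \<le> norm x" for x using f_le[of x] f_le[of "- x"] f.neg[of x] by simp
  moreover have "bounded_linear f"
    using f_abs by (intro bounded_linear_intro[where K = 1]) (auto simp: f.add f.scale)
  moreover have "e \<le> f c" if "c \<in> C" for c
  proof -
    have "f (- c) \<le> p (- c)" using f(2) by (simp add: le_fun_def)
    then show ?thesis using p_C[OF that] f.neg[of c] by simp
  qed
  ultimately show thesis using that by blast
qed

text \<open>The singleton \<open>{x}\<close> is convex and stays at distance \<open>norm x\<close>
  from zero, so separation applies to it.\<close>

corollary norming_functional:
  fixes x :: "'a::real_normed_vector"
  obtains f :: "'a \<Rightarrow> real" where "bounded_linear f" "\<And>y. \<bar>f y\<bar> \<le> norm y" "f x = norm x"
proof -
  obtain f :: "'a \<Rightarrow> real" where f: "bounded_linear f" "\<And>y. \<bar>f y\<bar> \<le> norm y" "norm x \<le> f x"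
    using convex_away_from_zero_separation[of "{x}" "norm x"] by auto
  have "f x = norm x" using f(2)[of x] f(3) by simp
  with f that show thesis by blast
qed

subsection \<open>The Schreier norm on finitely supported sequences\<close>

lemma sum_half_powers_le:
  assumes "finite A" "A \<subseteq> {k..}"
  shows "(\<Sum>j\<in>A. (1/2 :: real) ^ j) \<le> 2 * (1/2) ^ k"
proof -
  have "(\<Sum>j=k..<k+n. (1/2 :: real) ^ j) = 2 * (1/2) ^ k - 2 * (1/2) ^ (k + n)" for n
    by (induction n) simp_all
  moreover obtain n where "A \<subseteq> {k..<k+n}"
  proof -
    obtain N where "\<forall>j\<in>A. j < N" using assms(1) finite_nat_set_iff_bounded by blast
    then show thesis using assms(2) by (intro that[of N]) (auto simp: trans_less_add2)
  qed
  then have "(\<Sum>j\<in>A. (1/2 :: real) ^ j) \<le> (\<Sum>j=k..<k+n. (1/2) ^ j)" by (intro sum_mono2) auto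
  ultimately show ?thesis by (smt (verit) zero_le_power divide_nonneg_pos)
qed

lemma schreier_admissible_singleton: "schreier_admissible {i}"
  by (simp add: schreier_admissible_def)

lemma finitely_supported_bdd_above:
  assumes "finitely_supported u"
  shows "bdd_above {(\<Sum>i\<in>F. \<bar>u i\<bar>) | F. schreier_admissible F}"
proof (rule bdd_aboveI)
  fix s assume "s \<in> {(\<Sum>i\<in>F. \<bar>u i\<bar>) | F. schreier_admissible F}"
  then obtain F where F: "finite F" "s = (\<Sum>i\<in>F. \<bar>u i\<bar>)" by (auto simp: schreier_admissible_def)
  have "s = (\<Sum>i\<in>F \<inter> {i. u i \<noteq> 0}. \<bar>u i\<bar>)" unfolding F using F by (intro sum.mono_neutral_right) auto
  also have "\<dots> \<le> (\<Sum>i | u i \<noteq> 0. \<bar>u i\<bar>)"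
    using assms by (intro sum_mono2) (auto simp: finitely_supported_def)
  finally show "s \<le> (\<Sum>i | u i \<noteq> 0. \<bar>u i\<bar>)" .
qed

lemma schreier_norm_leI:
  assumes "\<And>F. schreier_admissible F \<Longrightarrow> (\<Sum>i\<in>F. \<bar>u i\<bar>) \<le> B"
  shows "schreier_norm u \<le> B"
  unfolding schreier_norm_def using assms schreier_admissible_singleton by (intro cSup_least) auto

lemma schreier_norm_upper:
  assumes "bdd_above {(\<Sum>i\<in>F. \<bar>u i\<bar>) | F. schreier_admissible F}" "schreier_admissible F"
  shows "(\<Sum>i\<in>F. \<bar>u i\<bar>) \<le> schreier_norm u"
  unfolding schreier_norm_def using assms by (intro cSup_upper) auto

lemma schreier_sum_le_norm:
  assumes "finitely_supported u" "schreier_admissible F"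
  shows "(\<Sum>i\<in>F. \<bar>u i\<bar>) \<le> schreier_norm u"
  using assms by (intro schreier_norm_upper finitely_supported_bdd_above)

lemma abs_le_schreier_norm:
  assumes "finitely_supported u"
  shows "\<bar>u i\<bar> \<le> schreier_norm u"
  using schreier_sum_le_norm[OF assms schreier_admissible_singleton[of i]] by simp

lemma schreier_norm_nonneg: "finitely_supported u \<Longrightarrow> 0 \<le> schreier_norm u"
  using abs_le_schreier_norm[of u 0] by linarith

lemma schreier_norm_mono:
  assumes "finitely_supported v" "\<And>i. \<bar>u i\<bar> \<le> \<bar>v i\<bar>"
  shows "schreier_norm u \<le> schreier_norm v"
proof (rule schreier_norm_leI)
  fix F assume "schreier_admissible F"
  then show "(\<Sum>i\<in>F. \<bar>u i\<bar>) \<le> schreier_norm v"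
    using schreier_sum_le_norm[OF assms(1)] sum_mono[of F "\<lambda>i. \<bar>u i\<bar>" "\<lambda>i. \<bar>v i\<bar>"] assms(2) by force
qed

lemma schreier_norm_add_le:
  assumes "finitely_supported u" "finitely_supported v"
  shows "schreier_norm (\<lambda>i. u i + v i) \<le> schreier_norm u + schreier_norm v"
proof (rule schreier_norm_leI)
  fix F assume F: "schreier_admissible F"
  have "(\<Sum>i\<in>F. \<bar>u i + v i\<bar>) \<le> (\<Sum>i\<in>F. \<bar>u i\<bar>) + (\<Sum>i\<in>F. \<bar>v i\<bar>)"
    unfolding sum.distrib[symmetric] by (intro sum_mono) auto
  then show "(\<Sum>i\<in>F. \<bar>u i + v i\<bar>) \<le> schreier_norm u + schreier_norm v"
    using schreier_sum_le_norm[OF assms(1) F] schreier_sum_le_norm[OF assms(2) F] by linarith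
qed

lemma schreier_norm_scale_le:
  assumes "finitely_supported u"
  shows "schreier_norm (\<lambda>i. c * u i) \<le> \<bar>c\<bar> * schreier_norm u"
proof (rule schreier_norm_leI)
  fix F assume F: "schreier_admissible F"
  have "(\<Sum>i\<in>F. \<bar>c * u i\<bar>) = \<bar>c\<bar> * (\<Sum>i\<in>F. \<bar>u i\<bar>)" by (simp add: abs_mult sum_distrib_left)
  also have "\<dots> \<le> \<bar>c\<bar> * schreier_norm u" using schreier_sum_le_norm[OF assms F] by (intro mult_left_mono) auto
  finally show "(\<Sum>i\<in>F. \<bar>c * u i\<bar>) \<le> \<bar>c\<bar> * schreier_norm u" .
qed

lemma finitely_supported_mono:
  "finitely_supported v \<Longrightarrow> (\<And>i. v i = 0 \<Longrightarrow> u i = 0) \<Longrightarrow> finitely_supported u"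
  unfolding finitely_supported_def by (erule finite_subset[rotated]) auto

lemma finitely_supported_bounded:
  assumes "\<And>i. q \<le> i \<Longrightarrow> u i = 0"
  shows "finitely_supported u"
proof -
  have "{i. u i \<noteq> 0} \<subseteq> {..<q}" using assms by (auto simp: not_less[symmetric])
  then show ?thesis unfolding finitely_supported_def by (rule finite_subset) simp
qed

lemma finitely_supportedE:
  assumes "finitely_supported u"
  obtains q where "\<And>i. q \<le> i \<Longrightarrow> u i = 0"
proof -
  obtain q where "\<forall>i\<in>{i. u i \<noteq> 0}. i < q"
    using assms finite_nat_set_iff_bounded unfolding finitely_supported_def by blast
  then show thesis using that[of q] by (metis leD mem_Collect_eq)
qed

lemma finitely_supported_add:
  assumes "finitely_supported u" "finitely_supported v"
  shows "finitely_supported (\<lambda>i. u i + v i)"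
  unfolding finitely_supported_def
  by (rule finite_subset[of _ "{i. u i \<noteq> 0} \<union> {i. v i \<noteq> 0}"])
    (use assms in \<open>auto simp: finitely_supported_def\<close>)

lemma finitely_supported_mult:
  "finitely_supported u \<Longrightarrow> finitely_supported (\<lambda>i. c i * u i)"
  by (erule finitely_supported_mono) simp

lemma finitely_supported_sum:
  "finite A \<Longrightarrow> (\<And>j. j \<in> A \<Longrightarrow> finitely_supported (u j)) \<Longrightarrow> finitely_supported (\<lambda>i. \<Sum>j\<in>A. u j i)"
proof (induction rule: finite_induct)
  case empty then show ?case by (simp add: finitely_supported_def)
next
  case (insert x F) then show ?case by (simp add: finitely_supported_add)
qed

section \<open>Linear combinations with finitely supported coefficients\<close>

definition lincomb :: "(nat \<Rightarrow> 'a::real_vector) \<Rightarrow> (nat \<Rightarrow> real) \<Rightarrow> 'a" where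
  "lincomb t u = (\<Sum>i | u i \<noteq> 0. u i *\<^sub>R t i)"

lemma lincomb_eq:
  assumes "finite A" "\<And>i. i \<notin> A \<Longrightarrow> u i = 0"
  shows "lincomb t u = (\<Sum>i\<in>A. u i *\<^sub>R t i)"
  unfolding lincomb_def using assms by (intro sum.mono_neutral_left) auto

lemma lincomb_eq_lessThan: "(\<And>i. q \<le> i \<Longrightarrow> u i = 0) \<Longrightarrow> lincomb t u = (\<Sum>i<q. u i *\<^sub>R t i)"
  by (intro lincomb_eq) auto

lemma lincomb_add:
  assumes "finitely_supported u" "finitely_supported v"
  shows "lincomb t (\<lambda>i. u i + v i) = lincomb t u + lincomb t v"
proof -
  let ?A = "{i. u i \<noteq> 0} \<union> {i. v i \<noteq> 0}"
  have fin: "finite ?A" using assms by (simp add: finitely_supported_def)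
  have "lincomb t (\<lambda>i. u i + v i) = (\<Sum>i\<in>?A. (u i + v i) *\<^sub>R t i)" by (rule lincomb_eq[OF fin]) auto
  also have "\<dots> = (\<Sum>i\<in>?A. u i *\<^sub>R t i) + (\<Sum>i\<in>?A. v i *\<^sub>R t i)" by (simp add: scaleR_left_distrib sum.distrib)
  also have "\<dots> = lincomb t u + lincomb t v" using lincomb_eq[OF fin, of u t] lincomb_eq[OF fin, of v t] by auto
  finally show ?thesis .
qed

lemma lincomb_scale:
  assumes "finitely_supported u"
  shows "lincomb t (\<lambda>i. c * u i) = c *\<^sub>R lincomb t u"
proof -
  have fin: "finite {i. u i \<noteq> 0}" using assms by (simp add: finitely_supported_def)
  show ?thesis using lincomb_eq[OF fin, of "\<lambda>i. c * u i" t] by (simp add: lincomb_def scaleR_sum_right)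
qed

lemma lincomb_diff:
  assumes "finitely_supported u" "finitely_supported v"
  shows "lincomb t (\<lambda>i. u i - v i) = lincomb t u - lincomb t v"
  using lincomb_add[OF assms(1) finitely_supported_mult[OF assms(2), of "\<lambda>_. - 1"], of t]
    lincomb_scale[OF assms(2), of t "- 1"] by simp

lemma lincomb_sum:
  "finite A \<Longrightarrow> (\<And>j. j \<in> A \<Longrightarrow> finitely_supported (u j)) \<Longrightarrow>
    lincomb t (\<lambda>i. \<Sum>j\<in>A. u j i) = (\<Sum>j\<in>A. lincomb t (u j))"
proof (induction rule: finite_induct)
  case empty then show ?case by (simp add: lincomb_def)
next
  case (insert x F) then show ?case by (simp add: lincomb_add finitely_supported_sum)
qed

lemma linear_lincomb: "linear f \<Longrightarrow> f (lincomb t u) = lincomb (\<lambda>i. f (t i)) u"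
  by (simp add: lincomb_def linear_sum linear_cmul)

text \<open>Let \<open>k\<close> be the first index whose support bound exceeds
  \<open>Min F\<close>. Earlier vectors vanish on \<open>F\<close>, and \<open>u k\<close>
  contributes at most \<open>M\<close>. The set \<open>F\<close> has at most \<open>q k\<close>
  elements, so flatness bounds the contribution of each later \<open>u j\<close> by
  \<open>(1/2) ^ j\<close>; these sum to at most 2.\<close>

lemma schreier_c0_estimate:
  assumes fs: "\<And>j. finitely_supported (u j)" and M: "\<And>j. schreier_norm (u j) \<le> M"
    and supp: "\<And>j i. q j \<le> i \<Longrightarrow> u j i = 0"
    and flat: "\<And>j k i. j < k \<Longrightarrow> \<bar>u k i\<bar> * real (q j) \<le> (1/2) ^ k"
    and a: "\<And>j. j \<le> n \<Longrightarrow> \<bar>a j\<bar> \<le> 1"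
  shows "schreier_norm (\<lambda>i. \<Sum>j\<le>n. a j * u j i) \<le> M + 2"
proof (rule schreier_norm_leI)
  fix F assume F: "schreier_admissible F"
  then have F': "finite F" "F \<noteq> {}" "card F \<le> Min F + 1" by (auto simp: schreier_admissible_def)
  define k where "k = (LEAST j. Min F < q j)"
  have "M \<ge> 0" using M[of 0] schreier_norm_nonneg[OF fs, of 0] by linarith
  have bound: "(\<Sum>i\<in>F. \<bar>u j i\<bar>) \<le> (if j = k then M else 0) + (1/2) ^ j" for j
  proof (cases "Min F < q j")
    case False
    have "u j i = 0" if "i \<in> F" for i
      using supp False Min_le[OF F'(1) that] by (meson leI le_trans)
    then show ?thesis using \<open>M \<ge> 0\<close> by simp
  next
    case True
    then have k: "Min F < q k" "k \<le> j" unfolding k_def by (rule LeastI, rule Least_le)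
    show ?thesis
    proof (cases "j = k")
      case True
      then show ?thesis using schreier_sum_le_norm[OF fs F, of j] M[of j] by (simp add: add_increasing2)
    next
      case False
      then have "k < j" using k by simp
      have "(\<Sum>i\<in>F. \<bar>u j i\<bar>) \<le> (\<Sum>i\<in>F. (1/2) ^ j / real (q k))"
        using flat[OF \<open>k < j\<close>] k by (intro sum_mono) (simp add: pos_le_divide_eq)
      also have "\<dots> = real (card F) * ((1/2) ^ j / real (q k))" by simp
      \<comment> \<open>Admissibility for indices from 0 gives
        \<open>card F \<le> Min F + 1 \<le> q k\<close>.\<close>
      also have "\<dots> \<le> real (q k) * ((1/2) ^ j / real (q k))"
        using F'(3) k by (intro mult_right_mono) auto
      also have "\<dots> = (1/2) ^ j" using k by simp
      finally show ?thesis using False by simp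
    qed
  qed
  have "(\<Sum>i\<in>F. \<bar>\<Sum>j\<le>n. a j * u j i\<bar>) \<le> (\<Sum>i\<in>F. \<Sum>j\<le>n. \<bar>u j i\<bar>)"
  proof (rule sum_mono)
    fix i
    have "\<bar>\<Sum>j\<le>n. a j * u j i\<bar> \<le> (\<Sum>j\<le>n. \<bar>a j * u j i\<bar>)" by (rule sum_abs)
    also have "\<dots> \<le> (\<Sum>j\<le>n. \<bar>u j i\<bar>)"
      using a by (intro sum_mono) (auto simp: abs_mult intro: mult_left_le_one_le)
    finally show "\<bar>\<Sum>j\<le>n. a j * u j i\<bar> \<le> (\<Sum>j\<le>n. \<bar>u j i\<bar>)" .
  qed
  also have "\<dots> = (\<Sum>j\<le>n. \<Sum>i\<in>F. \<bar>u j i\<bar>)" by (rule sum.swap)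
  also have "\<dots> \<le> (\<Sum>j\<le>n. (if j = k then M else 0) + (1/2) ^ j)" by (intro sum_mono bound)
  also have "\<dots> \<le> M + (\<Sum>j\<le>n. (1/2) ^ j)"
    using \<open>M \<ge> 0\<close> by (auto simp: sum.distrib)
  also have "(\<Sum>j\<le>n. (1/2 :: real) ^ j) \<le> 2"
    using sum_half_powers_le[of "{..n}" 0] by simp
  finally show "(\<Sum>i\<in>F. \<bar>\<Sum>j\<le>n. a j * u j i\<bar>) \<le> M + 2" by simp
qed

text \<open>If tails of the functional stayed large, there would be unit-ball vectors arbitrarily
  far out with value at least \<open>e\<close>. Averages of many successive ones keep the value
  \<open>e\<close> while their sup norm tends to zero. A rapidly flattening sequence of such
  averages satisfies \<open>schreier_c0_estimate\<close>, so sums of any length have norm at most 3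
  although their values grow linearly.\<close>

lemma schreier_shrinking:
  fixes g :: "nat \<Rightarrow> real"
  assumes g: "\<And>u. finitely_supported u \<Longrightarrow> \<bar>lincomb g u\<bar> \<le> C * schreier_norm u" and "e > 0"
  obtains m where "\<And>u. finitely_supported u \<Longrightarrow> \<forall>i<m. u i = 0 \<Longrightarrow>
    \<bar>lincomb g u\<bar> \<le> e * schreier_norm u"
proof (rule ccontr)
  assume "\<not> thesis"
  then have no: "\<exists>u. finitely_supported u \<and> (\<forall>i<m. u i = 0) \<and> e * schreier_norm u < \<bar>lincomb g u\<bar>" for m
    using that by (metis not_le)
  have block: "\<exists>u. finitely_supported u \<and> (\<forall>i<m. u i = 0) \<and> schreier_norm u \<le> 1 \<and> e \<le> lincomb g u" for m
  proof -
    obtain u where u: "finitely_supported u" "\<forall>i<m. u i = 0" "e * schreier_norm u < \<bar>lincomb g u\<bar>"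
      using no by blast
    have n0: "schreier_norm u \<ge> 0" by (rule schreier_norm_nonneg[OF u(1)])
    have "schreier_norm u > 0"
    proof (rule ccontr)
      assume "\<not> ?thesis"
      with n0 have "schreier_norm u = 0" by simp
      then show False using g[OF u(1)] u(3) by simp
    qed
    define c where "c = sgn (lincomb g u) / schreier_norm u"
    have "lincomb g (\<lambda>i. c * u i) = \<bar>lincomb g u\<bar> / schreier_norm u"
      using lincomb_scale[OF u(1), of g c] by (auto simp: c_def sgn_if)
    moreover have "\<bar>lincomb g u\<bar> / schreier_norm u \<ge> e"
      using u(3) \<open>schreier_norm u > 0\<close> by (simp add: pos_le_divide_eq)
    moreover have "schreier_norm (\<lambda>i. c * u i) \<le> 1"
    proof -
      have "\<bar>c\<bar> \<le> 1 / schreier_norm u" using \<open>schreier_norm u > 0\<close> by (auto simp: c_def sgn_if)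
      then have "\<bar>c\<bar> * schreier_norm u \<le> 1"
        using \<open>schreier_norm u > 0\<close> by (simp add: pos_le_divide_eq)
      then show ?thesis using schreier_norm_scale_le[OF u(1), of c] by linarith
    qed
    ultimately show ?thesis using u finitely_supported_mult[OF u(1), of "\<lambda>_. c"]
      by (intro exI[of _ "\<lambda>i. c * u i"]) auto
  qed
  \<comment> \<open>Sums of \<open>N\<close> blocks with disjoint supports: the Schreier norm may
    grow like \<open>N\<close>, but the sup norm stays at most 1. Division by \<open>N\<close>
    therefore flattens them.\<close>
  have blocks: "\<exists>w. finitely_supported w \<and> schreier_norm w \<le> real N \<and> (\<forall>i. \<bar>w i\<bar> \<le> 1) \<and>
      real N * e \<le> lincomb g w" for N
  proof (induction N)
    case 0
    then show ?case
      by (intro exI[of _ "\<lambda>_. 0"]) (auto simp: finitely_supported_def lincomb_def intro!: schreier_norm_leI)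
  next
    case (Suc N)
    then obtain w where w: "finitely_supported w" "schreier_norm w \<le> real N" "\<And>i. \<bar>w i\<bar> \<le> 1"
      "real N * e \<le> lincomb g w" by blast
    obtain q where q: "\<And>i. q \<le> i \<Longrightarrow> w i = 0" using w(1) by (rule finitely_supportedE) blast
    obtain u where u: "finitely_supported u" "\<forall>i<q. u i = 0" "schreier_norm u \<le> 1" "e \<le> lincomb g u"
      using block by blast
    have "\<bar>w i + u i\<bar> \<le> 1" for i
      using q[of i] u(2) w(3)[of i] abs_le_schreier_norm[OF u(1), of i] u(3)
      by (cases "q \<le> i") auto
    moreover have "schreier_norm (\<lambda>i. w i + u i) \<le> real (Suc N)"
      using schreier_norm_add_le[OF w(1) u(1)] w(2) u(3) by simp
    moreover have "real (Suc N) * e \<le> lincomb g (\<lambda>i. w i + u i)"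
      using lincomb_add[OF w(1) u(1), of g] w(4) u(4) by (simp add: distrib_right)
    ultimately show ?case using finitely_supported_add[OF w(1) u(1)] by blast
  qed
  have avg: "\<exists>w. finitely_supported w \<and> schreier_norm w \<le> 1 \<and> (\<forall>i. \<bar>w i\<bar> \<le> d) \<and> e \<le> lincomb g w"
    if d: "d > 0" for d
  proof -
    obtain N :: nat where N: "real N > 1 / d" using reals_Archimedean2 by blast
    have "real N > 0" using N d by (meson less_trans zero_less_divide_1_iff)
    obtain w where w: "finitely_supported w" "schreier_norm w \<le> real N" "\<And>i. \<bar>w i\<bar> \<le> 1"
      "real N * e \<le> lincomb g w" using blocks by blast
    let ?w = "\<lambda>i. (1 / real N) * w i"
    have "schreier_norm ?w \<le> 1"
    proof -
      have "schreier_norm ?w \<le> (1 / real N) * schreier_norm w"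
        using schreier_norm_scale_le[OF w(1), of "1 / real N"] by simp
      also have "\<dots> \<le> (1 / real N) * real N" using w(2) by (intro mult_left_mono) auto
      finally show ?thesis using \<open>real N > 0\<close> by simp
    qed
    moreover have "\<bar>?w i\<bar> \<le> d" for i
    proof -
      have "\<bar>?w i\<bar> \<le> 1 / real N" using w(3)[of i] \<open>real N > 0\<close> by (simp add: abs_mult divide_right_mono)
      also have "\<dots> \<le> d" using N d \<open>real N > 0\<close> by (simp add: field_simps)
      finally show ?thesis .
    qed
    moreover have "e \<le> lincomb g ?w"
      using lincomb_scale[OF w(1), of g "1 / real N"] w(4) \<open>real N > 0\<close>
      by (simp add: pos_le_divide_eq mult.commute)
    ultimately show ?thesis using finitely_supported_mult[OF w(1), of "\<lambda>_. 1 / real N"] by blast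
  qed
  define P where "P = (\<lambda>(w, q). finitely_supported w \<and> schreier_norm w \<le> 1 \<and> e \<le> lincomb g w \<and>
    (\<forall>i\<ge>q :: nat. w i = 0))"
  \<comment> \<open>The flatness of the next average is measured against the support bound of the
    current one; monotone bounds extend this to all earlier ones.\<close>
  define Q where "Q = (\<lambda>n (w :: nat \<Rightarrow> real, q :: nat) (w' :: nat \<Rightarrow> real, q' :: nat). q \<le> q' \<and>
    (\<forall>i. \<bar>w' i\<bar> * real q \<le> (1/2) ^ Suc n))"
  have ex: "\<exists>y. P y \<and> Q n x y" for n x
  proof -
    obtain w0 q0 where x: "x = (w0, q0)" by (cases x)
    obtain w where w: "finitely_supported w" "schreier_norm w \<le> 1" "\<forall>i. \<bar>w i\<bar> \<le> (1/2) ^ Suc n / (real q0 + 1)"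
      "e \<le> lincomb g w" using avg[of "(1/2) ^ Suc n / (real q0 + 1)"] by auto
    obtain q where q: "\<And>i. q \<le> i \<Longrightarrow> w i = 0" using w(1) by (rule finitely_supportedE) blast
    have "\<bar>w i\<bar> * real q0 \<le> (1/2) ^ Suc n" for i
    proof -
      have "\<bar>w i\<bar> * real q0 \<le> \<bar>w i\<bar> * (real q0 + 1)" by (intro mult_left_mono) auto
      also have "\<dots> \<le> (1/2) ^ Suc n" using w(3)
        by (intro iffD1[OF pos_le_divide_eq]) auto
      finally show ?thesis .
    qed
    then show ?thesis using w q by (intro exI[of _ "(w, max q q0)"]) (auto simp: P_def Q_def x)
  qed
  have "\<exists>f. \<forall>n. P (f n) \<and> Q n (f n) (f (Suc n))"
    by (rule dependent_nat_choice) (use ex in blast)+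
  then obtain f where f: "\<And>n. P (f n)" "\<And>n. Q n (f n) (f (Suc n))" by blast
  define w where "w = fst \<circ> f"
  define q where "q = snd \<circ> f"
  have w: "finitely_supported (w n)" "schreier_norm (w n) \<le> 1" "e \<le> lincomb g (w n)"
    "q n \<le> i \<Longrightarrow> w n i = 0" "q n \<le> q (Suc n)" "\<bar>w (Suc n) i\<bar> * real (q n) \<le> (1/2) ^ Suc n" for n i
    using f(1)[of n] f(2)[of n] by (auto simp: P_def Q_def w_def q_def split: prod.splits)
  have flat: "\<bar>w k i\<bar> * real (q j) \<le> (1/2) ^ k" if "j < k" for j k i
  proof -
    obtain k' where k: "k = Suc k'" "j \<le> k'" using \<open>j < k\<close> by (cases k) auto
    have "q j \<le> q k'" using w(5) k(2) by (rule lift_Suc_mono_le)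
    then have "\<bar>w k i\<bar> * real (q j) \<le> \<bar>w k i\<bar> * real (q k')" by (intro mult_left_mono) auto
    also have "\<dots> \<le> (1/2) ^ k" using w(6)[of k' i] k by simp
    finally show ?thesis .
  qed
  have "real (Suc n) * e \<le> \<bar>C\<bar> * 3" for n
  proof -
    \<comment> \<open>The factor 1 brings the sum into the form required by
      \<open>schreier_c0_estimate\<close>.\<close>
    let ?s = "\<lambda>i. \<Sum>j\<le>n. 1 * w j i"
    have fs: "finitely_supported ?s" using w(1) by (intro finitely_supported_sum) auto
    have "real (Suc n) * e = (\<Sum>j\<le>n. e)" by simp
    also have "\<dots> \<le> (\<Sum>j\<le>n. lincomb g (w j))" by (intro sum_mono w(3))
    also have "\<dots> = lincomb g ?s" using lincomb_sum[of "{..n}" w g] w(1) by simp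
    also have "\<dots> \<le> C * schreier_norm ?s" using g[OF fs] by linarith
    also have "\<dots> \<le> \<bar>C\<bar> * schreier_norm ?s" using schreier_norm_nonneg[OF fs] by (intro mult_right_mono) auto
    also have "\<dots> \<le> \<bar>C\<bar> * (1 + 2)"
      using w(1,2,4) flat by (intro mult_left_mono schreier_c0_estimate[where q = q]) auto
    finally show ?thesis by simp
  qed
  moreover obtain n :: nat where "\<bar>C\<bar> * 3 / e < real n" using reals_Archimedean2 by blast
  then have "\<bar>C\<bar> * 3 < real n * e" using \<open>e > 0\<close> by (simp add: field_simps)
  ultimately have "real (Suc n) * e < real n * e" by (meson le_less_trans)
  then show False using \<open>e > 0\<close> by simp
qed

subsection \<open>Weakly null sequences and the basis of c0\<close>

text \<open>A linear image of a cube, introduced for its compactness: it makes estimates uniform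
  over all bounded coefficients and provides norm limits of bounded combinations of a fixed finite
  family.\<close>

definition box_sums :: "(nat \<Rightarrow> 'a::real_normed_vector) \<Rightarrow> nat \<Rightarrow> 'a set" where
  "box_sums v n = {\<Sum>i<n. a i *\<^sub>R v i | a :: nat \<Rightarrow> real. \<forall>i. \<bar>a i\<bar> \<le> 1}"

lemma box_sums_Suc:
  "box_sums v (Suc n) = {x + y | x y. x \<in> box_sums v n \<and> y \<in> (\<lambda>\<alpha>. \<alpha> *\<^sub>R v n) ` {-1..1}}"
proof (intro equalityI subsetI)
  fix z assume "z \<in> box_sums v (Suc n)"
  then obtain a :: "nat \<Rightarrow> real" where a: "\<forall>i. \<bar>a i\<bar> \<le> 1" "z = (\<Sum>i<n. a i *\<^sub>R v i) + a n *\<^sub>R v n"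
    by (auto simp: box_sums_def)
  have "a n *\<^sub>R v n \<in> (\<lambda>\<alpha>. \<alpha> *\<^sub>R v n) ` {-1..1}"
    using a(1) by (intro imageI) (auto simp: abs_le_iff minus_le_iff)
  moreover have "(\<Sum>i<n. a i *\<^sub>R v i) \<in> box_sums v n" using a(1) by (auto simp: box_sums_def)
  ultimately show "z \<in> {x + y | x y. x \<in> box_sums v n \<and> y \<in> (\<lambda>\<alpha>. \<alpha> *\<^sub>R v n) ` {-1..1}}"
    using a(2) by blast
next
  fix z assume "z \<in> {x + y | x y. x \<in> box_sums v n \<and> y \<in> (\<lambda>\<alpha>. \<alpha> *\<^sub>R v n) ` {-1..1}}"
  then obtain a :: "nat \<Rightarrow> real" and \<alpha> where a: "\<forall>i. \<bar>a i\<bar> \<le> 1" "\<alpha> \<in> {-1..1}"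
    "z = (\<Sum>i<n. a i *\<^sub>R v i) + \<alpha> *\<^sub>R v n"
    by (auto simp: box_sums_def)
  then have "z = (\<Sum>i<Suc n. (a(n := \<alpha>)) i *\<^sub>R v i)" "\<forall>i. \<bar>(a(n := \<alpha>)) i\<bar> \<le> 1" by auto
  then show "z \<in> box_sums v (Suc n)" unfolding box_sums_def by blast
qed

lemma compact_box_sums: "compact (box_sums v n)"
proof (induction n)
  case 0
  have "box_sums v 0 = {0}" by (auto simp: box_sums_def intro: exI[of _ "\<lambda>_. 0"])
  then show ?case by simp
next
  case (Suc n)
  have "compact ((\<lambda>\<alpha>. \<alpha> *\<^sub>R v n) ` {-1..1 :: real})"
    by (intro compact_continuous_image continuous_intros) auto
  with Suc show ?case unfolding box_sums_Suc by (rule compact_sums)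
qed

lemma sum_in_box_sums:
  assumes "F \<subseteq> {..<n}" "\<And>i. i \<in> F \<Longrightarrow> \<bar>a i\<bar> \<le> 1"
  shows "(\<Sum>i\<in>F. a i *\<^sub>R v i) \<in> box_sums v n"
proof -
  let ?b = "\<lambda>i. if i \<in> F then a i else 0"
  have "(\<Sum>i\<in>F. a i *\<^sub>R v i) = (\<Sum>i<n. ?b i *\<^sub>R v i)"
    using assms(1) by (intro sum.mono_neutral_cong_left) auto
  then show ?thesis unfolding box_sums_def using assms(2) by (intro CollectI exI[of _ ?b]) auto
qed

lemma weakly_nullD: "weakly_null v \<Longrightarrow> bounded_linear f \<Longrightarrow> (\<lambda>n. f (v n)) \<longlonglongrightarrow> (0 :: real)"
  by (simp add: weakly_null_def)

text \<open>For a single \<open>x\<close>, a norming functional shows that adding a far term barely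
  lowers the norm. Uniformity on \<open>K\<close> follows by compactness: counterexamples accumulate
  at some \<open>l\<close>, and the functional norming \<open>l\<close> contradicts them.\<close>

lemma weakly_null_perturbation:
  fixes v :: "nat \<Rightarrow> 'a::real_normed_vector"
  assumes "compact K" "weakly_null v" "e > 0"
  obtains m where "\<And>r x \<alpha>. m \<le> r \<Longrightarrow> x \<in> K \<Longrightarrow> \<bar>\<alpha>\<bar> \<le> 1 \<Longrightarrow> norm x - e \<le> norm (x + \<alpha> *\<^sub>R v r)"
proof (rule ccontr)
  assume "\<not> thesis"
  then have "\<forall>m. \<exists>r x \<alpha>. m \<le> r \<and> x \<in> K \<and> \<bar>\<alpha>\<bar> \<le> 1 \<and> norm (x + \<alpha> *\<^sub>R v r) < norm x - e"
    using that by (metis not_le)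
  then obtain r x \<alpha> where *: "\<And>m. m \<le> r m" "\<And>m. x m \<in> K" "\<And>m. \<bar>\<alpha> m\<bar> \<le> (1 :: real)"
    "\<And>m. norm (x m + \<alpha> m *\<^sub>R v (r m)) < norm (x m) - e" by metis
  obtain l s where ls: "l \<in> K" "strict_mono s" "(x \<circ> s) \<longlonglongrightarrow> l"
    using assms(1) *(2) unfolding compact_def by blast
  obtain f :: "'a \<Rightarrow> real" where f: "bounded_linear f" "\<And>y. \<bar>f y\<bar> \<le> norm y" "f l = norm l"
    using norming_functional[of l] by blast
  interpret f: bounded_linear f by fact
  have r_top: "filterlim (\<lambda>k. r (s k)) at_top sequentially"
  proof (rule filterlim_at_top_mono)
    show "filterlim s at_top sequentially" using ls(2) by (rule filterlim_subseq)
    show "\<forall>\<^sub>F k in sequentially. s k \<le> r (s k)" using *(1) by simp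
  qed
  have "(\<lambda>k. f (v (r (s k)))) \<longlonglongrightarrow> 0"
    using filterlim_compose[OF weakly_nullD[OF assms(2) f(1)] r_top] .
  then have lim: "(\<lambda>k. \<bar>f (v (r (s k)))\<bar>) \<longlonglongrightarrow> 0" by (rule tendsto_rabs_zero)
  have "norm (\<alpha> (s k) * f (v (r (s k)))) \<le> \<bar>f (v (r (s k)))\<bar>" for k
    using *(3)[of "s k"] by (simp add: abs_mult mult_left_le_one_le)
  then have "(\<lambda>k. \<alpha> (s k) * f (v (r (s k)))) \<longlonglongrightarrow> 0"
    by (intro Lim_null_comparison[OF _ lim]) auto
  moreover have "(\<lambda>k. f (x (s k))) \<longlonglongrightarrow> f l" using f.tendsto[OF ls(3)] by (simp add: o_def)
  ultimately have "(\<lambda>k. f (x (s k)) + \<alpha> (s k) * f (v (r (s k)))) \<longlonglongrightarrow> f l + 0" by (intro tendsto_add)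
  moreover have "(\<lambda>k. norm (x (s k)) - e) \<longlonglongrightarrow> norm l - e"
    using ls(3) by (intro tendsto_intros) (simp add: o_def)
  moreover have "f (x (s k)) + \<alpha> (s k) * f (v (r (s k))) \<le> norm (x (s k)) - e" for k
  proof -
    have "f (x (s k)) + \<alpha> (s k) * f (v (r (s k))) = f (x (s k) + \<alpha> (s k) *\<^sub>R v (r (s k)))"
      by (simp add: f.add f.scaleR)
    also have "\<dots> \<le> norm (x (s k) + \<alpha> (s k) *\<^sub>R v (r (s k)))" using f(2) abs_le_D1 by blast
    finally show ?thesis using *(4)[of "s k"] by linarith
  qed
  ultimately have "f l + 0 \<le> norm l - e" by (intro LIMSEQ_le) auto
  then show False using f(3) \<open>e > 0\<close> by simp
qed

text \<open>The usual selection of a basic sequence. Each new term may lower the norm of a partial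
  sum by at most \<open>c / 8 * (1/2) ^ n\<close>, hence by at most \<open>c / 4\<close> altogether,
  and some partial sum has norm at least \<open>c / 2\<close>.\<close>

lemma weakly_null_lower_c0_subsequence:
  fixes v :: "nat \<Rightarrow> 'a::real_normed_vector"
  assumes "weakly_null v" "c > 0" and c: "\<And>n. c \<le> norm (v n)"
  obtains s :: "nat \<Rightarrow> nat" where "strict_mono s"
    "\<forall>a n m. (\<forall>k\<le>n. \<bar>a k\<bar> \<le> 1) \<longrightarrow> m \<le> n \<longrightarrow> \<bar>a m\<bar> = 1 \<longrightarrow>
      c / 4 \<le> norm (\<Sum>k\<le>n. a k *\<^sub>R v (s k))"
proof -
  have "\<exists>s. \<forall>n. True \<and> (s n < s (Suc n) \<and> (\<forall>x\<in>box_sums v (Suc (s n)). \<forall>\<alpha>. \<bar>\<alpha>\<bar> \<le> 1 \<longrightarrow>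
      norm x - c / 8 * (1/2) ^ n \<le> norm (x + \<alpha> *\<^sub>R v (s (Suc n)))))"
  proof (rule dependent_nat_choice)
    fix r n :: nat
    obtain m where "\<And>r' x \<alpha>. m \<le> r' \<Longrightarrow> x \<in> box_sums v (Suc r) \<Longrightarrow> \<bar>\<alpha>\<bar> \<le> 1 \<Longrightarrow>
        norm x - c / 8 * (1/2) ^ n \<le> norm (x + \<alpha> *\<^sub>R v r')"
      using weakly_null_perturbation[OF compact_box_sums assms(1), of "c / 8 * (1/2) ^ n"] \<open>c > 0\<close>
      by (metis divide_pos_pos mult_pos_pos zero_less_numeral zero_less_one zero_less_power)
    then show "\<exists>r'. True \<and> (r < r' \<and> (\<forall>x\<in>box_sums v (Suc r). \<forall>\<alpha>. \<bar>\<alpha>\<bar> \<le> 1 \<longrightarrow>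
        norm x - c / 8 * (1/2) ^ n \<le> norm (x + \<alpha> *\<^sub>R v r')))"
      by (intro exI[of _ "max m (Suc r)"]) auto
  qed simp
  then obtain s where s: "\<And>n. s n < s (Suc n)"
    "\<And>n x \<alpha>. x \<in> box_sums v (Suc (s n)) \<Longrightarrow> \<bar>\<alpha>\<bar> \<le> 1 \<Longrightarrow>
      norm x - c / 8 * (1/2) ^ n \<le> norm (x + \<alpha> *\<^sub>R v (s (Suc n)))" by blast
  have mono: "strict_mono s" using s(1) by (simp add: strict_mono_Suc_iff)
  then have inj: "inj s" by (rule strict_mono_imp_inj_on)
  have "c / 4 \<le> norm (\<Sum>k\<le>n. a k *\<^sub>R v (s k))"
    if a: "\<And>k. k \<le> n \<Longrightarrow> \<bar>a k\<bar> \<le> 1" and m: "m \<le> n" "\<bar>a m\<bar> = 1" for a :: "nat \<Rightarrow> real" and n m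
  proof -
    define S where "S = (\<lambda>k. \<Sum>i\<le>k. a i *\<^sub>R v (s i))"
    have in_box: "S k \<in> box_sums v (Suc (s k))" if "k \<le> n" for k
    proof -
      have "S k = (\<Sum>i\<in>s ` {..k}. a (inv s i) *\<^sub>R v i)"
        using inj unfolding S_def by (subst sum.reindex) (auto simp: inv_f_f intro: inj_on_subset)
      moreover have "s ` {..k} \<subseteq> {..<Suc (s k)}"
        using mono by (auto simp: less_Suc_eq_le strict_mono_less_eq)
      ultimately show ?thesis
        using a that inj by (auto intro!: sum_in_box_sums simp: inv_f_f)
    qed
    have drop: "norm (S k) - (\<Sum>i=k..<l. c / 8 * (1/2) ^ i) \<le> norm (S l)" if "k \<le> l" "l \<le> n" for k l
      using that
    proof (induction l rule: dec_induct)
      case (step l)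
      have "norm (S l) - c / 8 * (1/2) ^ l \<le> norm (S l + a (Suc l) *\<^sub>R v (s (Suc l)))"
        using step a by (intro s(2) in_box) auto
      moreover have "S (Suc l) = S l + a (Suc l) *\<^sub>R v (s (Suc l))" by (simp add: S_def)
      ultimately show ?case using step by simp
    qed simp
    have "norm (S k) - c / 4 \<le> norm (S n)" if "k \<le> n" for k
    proof -
      have "(\<Sum>i=k..<n. c / 8 * (1/2) ^ i) = c / 8 * (\<Sum>i=k..<n. (1/2) ^ i)" by (simp add: sum_distrib_left)
      also have "\<dots> \<le> c / 8 * (2 * (1/2) ^ 0)"
        using \<open>c > 0\<close> by (intro mult_left_mono sum_half_powers_le) auto
      finally show ?thesis using drop[OF that order.refl] by simp
    qed
    \<comment> \<open>Two consecutive partial sums differ by a term of norm at least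
      \<open>c\<close>, so they cannot both have norm below \<open>c / 2\<close>.\<close>
    moreover have "\<exists>k\<le>n. c / 2 \<le> norm (S k)"
    proof (cases m)
      case 0
      then have "norm (S m) = norm (v (s m))" using m by (simp add: S_def)
      then show ?thesis using c[of "s m"] \<open>c > 0\<close> m by (intro exI[of _ m]) auto
    next
      case (Suc m')
      then have "S m = S m' + a m *\<^sub>R v (s m)" by (simp add: S_def)
      then have "norm (a m *\<^sub>R v (s m)) \<le> norm (S m) + norm (S m')"
        using norm_triangle_ineq4[of "S m" "S m'"] by simp
      then have "c \<le> norm (S m) + norm (S m')" using c[of "s m"] m by simp
      then have "c / 2 \<le> norm (S m) \<or> c / 2 \<le> norm (S m')" by linarith
      then show ?thesis using m Suc by (metis Suc_leD)
    qed
    ultimately obtain k where "norm (S k) - c / 4 \<le> norm (S n)" "c / 2 \<le> norm (S k)" by blast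
    then show ?thesis unfolding S_def by linarith
  qed
  with mono that show thesis by blast
qed

text \<open>Both inequalities are homogeneous in the coefficients, so it suffices to treat maximum
  1, with some coefficient attaining it.\<close>

lemma equivalent_to_c0_basisI:
  fixes y :: "nat \<Rightarrow> 'a::real_normed_vector"
  assumes "A > 0" "B > 0"
    and upper: "\<And>a n. (\<And>k. k \<le> n \<Longrightarrow> \<bar>a k\<bar> \<le> 1) \<Longrightarrow> norm (\<Sum>k\<le>n. a k *\<^sub>R y k) \<le> B"
    and lower: "\<And>a n m. (\<And>k. k \<le> n \<Longrightarrow> \<bar>a k\<bar> \<le> 1) \<Longrightarrow> m \<le> n \<Longrightarrow> \<bar>a m\<bar> = 1 \<Longrightarrow>
      A \<le> norm (\<Sum>k\<le>n. a k *\<^sub>R y k)"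
  shows "equivalent_to_c0_basis y"
proof -
  have "A * Max ((\<lambda>k. \<bar>a k\<bar>) ` {..n}) \<le> norm (\<Sum>k\<le>n. a k *\<^sub>R y k) \<and>
      norm (\<Sum>k\<le>n. a k *\<^sub>R y k) \<le> B * Max ((\<lambda>k. \<bar>a k\<bar>) ` {..n})" for a :: "nat \<Rightarrow> real" and n
  proof -
    define \<mu> where "\<mu> = Max ((\<lambda>k. \<bar>a k\<bar>) ` {..n})"
    have le: "\<bar>a k\<bar> \<le> \<mu>" if "k \<le> n" for k unfolding \<mu>_def using that by (intro Max_ge) auto
    have "\<mu> \<in> (\<lambda>k. \<bar>a k\<bar>) ` {..n}" unfolding \<mu>_def by (intro Max_in) auto
    then obtain m where m: "m \<le> n" "\<mu> = \<bar>a m\<bar>" by auto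
    show ?thesis
    proof (cases "\<mu> = 0")
      case True
      then have "(\<Sum>k\<le>n. a k *\<^sub>R y k) = 0" using le by (intro sum.neutral) auto
      then show ?thesis using True by (simp add: \<mu>_def)
    next
      case False
      with m have \<mu>: "\<mu> > 0" by simp
      have b: "\<bar>a k / \<mu>\<bar> \<le> 1" if "k \<le> n" for k using le[OF that] \<mu> by simp
      have eq: "norm (\<Sum>k\<le>n. a k *\<^sub>R y k) = \<mu> * norm (\<Sum>k\<le>n. (a k / \<mu>) *\<^sub>R y k)"
      proof -
        have "(\<Sum>k\<le>n. a k *\<^sub>R y k) = \<mu> *\<^sub>R (\<Sum>k\<le>n. (a k / \<mu>) *\<^sub>R y k)"
          using \<mu> by (simp add: scaleR_sum_right)
        then show ?thesis using \<mu> by simp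
      qed
      have "norm (\<Sum>k\<le>n. (a k / \<mu>) *\<^sub>R y k) \<le> B" using b by (rule upper)
      moreover have "A \<le> norm (\<Sum>k\<le>n. (a k / \<mu>) *\<^sub>R y k)" using b m(1) \<mu> m(2) by (intro lower) auto
      ultimately show ?thesis unfolding eq \<mu>_def[symmetric] using \<mu> by (simp add: mult.commute)
    qed
  qed
  then show ?thesis unfolding equivalent_to_c0_basis_def using assms(1,2) by blast
qed

lemma upper_c0_finite_sum:
  fixes v :: "nat \<Rightarrow> 'a::real_normed_vector"
  assumes upper: "\<And>a n. (\<And>k. k \<le> n \<Longrightarrow> \<bar>a k\<bar> \<le> 1) \<Longrightarrow> norm (\<Sum>k\<le>n. a k *\<^sub>R v k) \<le> B"
    and "finite F" "\<And>k. k \<in> F \<Longrightarrow> \<bar>a k\<bar> \<le> 1"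
  shows "norm (\<Sum>k\<in>F. a k *\<^sub>R v k) \<le> B"
proof -
  obtain n where n: "F \<subseteq> {..n}" using assms(2) by (auto simp: finite_nat_set_iff_bounded_le)
  let ?b = "\<lambda>k. if k \<in> F then a k else 0"
  have "(\<Sum>k\<in>F. a k *\<^sub>R v k) = (\<Sum>k\<le>n. ?b k *\<^sub>R v k)"
    using n by (intro sum.mono_neutral_cong_left) auto
  also have "norm \<dots> \<le> B" using assms(3) by (intro upper) auto
  finally show ?thesis .
qed

text \<open>Taking the signs of \<open>f (v k)\<close> as coefficients bounds the sums of
  \<open>\<bar>f (v k)\<bar>\<close>, so the values are absolutely summable and tend to
  zero.\<close>

lemma upper_c0_weakly_null:
  fixes v :: "nat \<Rightarrow> 'a::real_normed_vector"
  assumes upper: "\<And>a n. (\<And>k. k \<le> n \<Longrightarrow> \<bar>a k\<bar> \<le> 1) \<Longrightarrow> norm (\<Sum>k\<le>n. a k *\<^sub>R v k) \<le> B"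
  shows "weakly_null v"
  unfolding weakly_null_def
proof (intro allI impI)
  fix f :: "'a \<Rightarrow> real" assume "bounded_linear f"
  then interpret f: bounded_linear f .
  obtain K where K: "\<And>x. norm (f x) \<le> norm x * K" "K > 0" using f.pos_bounded by blast
  have "(\<Sum>k\<le>n. norm (f (v k))) \<le> B * K" for n
  proof -
    have "(\<Sum>k\<le>n. norm (f (v k))) = (\<Sum>k\<le>n. sgn (f (v k)) * f (v k))"
      by (intro sum.cong) (auto simp: sgn_if)
    also have "\<dots> = f (\<Sum>k\<le>n. sgn (f (v k)) *\<^sub>R v k)" by (simp add: f.sum f.scaleR)
    also have "\<dots> \<le> norm (\<Sum>k\<le>n. sgn (f (v k)) *\<^sub>R v k) * K" using K(1) by (metis abs_le_D1 real_norm_def)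
    also have "\<dots> \<le> B * K" using K(2) by (intro mult_right_mono upper) (auto simp: sgn_if)
    finally show ?thesis .
  qed
  then have "summable (\<lambda>k. norm (f (v k)))" by (intro bounded_imp_summable) auto
  then show "(\<lambda>k. f (v k)) \<longlonglongrightarrow> 0" using summable_LIMSEQ_zero tendsto_norm_zero_iff by blast
qed

text \<open>The upper estimate serves twice: it gives the weak nullness that the selection of a
  lower estimate needs, and it is inherited by the selected subsequence.\<close>

lemma upper_c0_imp_c0_subsequence:
  fixes v :: "nat \<Rightarrow> 'a::real_normed_vector"
  assumes upper: "\<And>a n. (\<And>k. k \<le> n \<Longrightarrow> \<bar>a k\<bar> \<le> 1) \<Longrightarrow> norm (\<Sum>k\<le>n. a k *\<^sub>R v k) \<le> B"
    and "c > 0" "\<And>n. c \<le> norm (v n)"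
  obtains s :: "nat \<Rightarrow> nat" where "strict_mono s" "equivalent_to_c0_basis (v \<circ> s)"
proof -
  have wn: "weakly_null v" using upper by (rule upper_c0_weakly_null)
  obtain s :: "nat \<Rightarrow> nat" where s: "strict_mono s"
    "\<forall>a n m. (\<forall>k\<le>n. \<bar>a k\<bar> \<le> 1) \<longrightarrow> m \<le> n \<longrightarrow> \<bar>a m\<bar> = 1 \<longrightarrow>
      c / 4 \<le> norm (\<Sum>k\<le>n. a k *\<^sub>R v (s k))"
    using weakly_null_lower_c0_subsequence[OF wn assms(2,3)] by blast
  have "equivalent_to_c0_basis (v \<circ> s)"
  \<comment> \<open>The upper constant has to be positive, hence \<open>max B 1\<close>.\<close>
  proof (rule equivalent_to_c0_basisI[where A = "c / 4" and B = "max B 1"])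
    fix a :: "nat \<Rightarrow> real" and n assume a: "\<And>k. k \<le> n \<Longrightarrow> \<bar>a k\<bar> \<le> 1"
    have inj: "inj s" using s(1) by (rule strict_mono_imp_inj_on)
    have "(\<Sum>k\<le>n. a k *\<^sub>R (v \<circ> s) k) = (\<Sum>i\<in>s ` {..n}. a (inv s i) *\<^sub>R v i)"
      using inj by (subst sum.reindex) (auto simp: inv_f_f intro: inj_on_subset)
    also have "norm \<dots> \<le> B"
      using a inj by (intro upper_c0_finite_sum[OF upper]) (auto simp: inv_f_f)
    finally show "norm (\<Sum>k\<le>n. a k *\<^sub>R (v \<circ> s) k) \<le> max B 1" by simp
  qed (use assms(2) s(2) in auto)
  with s(1) that show thesis by blast
qed

section \<open>Subsequences of blocks and blocks of subsequences\<close>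

lemma block_basis_of_1_averages_comp:
  assumes "block_basis_of_1_averages x y" "strict_mono s"
  shows "block_basis_of_1_averages x (y \<circ> s)"
proof -
  obtain lam F where *: "\<And>k. lam k > (0 :: real) \<and> finite (F k) \<and> F k \<noteq> {} \<and> Max (F k) < Min (F (Suc k))"
    "\<And>k. y k = lam k *\<^sub>R (\<Sum>n\<in>F k. x n)"
    using assms(1) unfolding block_basis_of_1_averages_def by blast
  have lt: "Max (F j) < Min (F k)" if "j < k" for j k
    using that
  proof (induction k)
    case (Suc k)
    show ?case
    proof (cases "j = k")
      case False
      then have "Max (F j) < Min (F k)" using Suc by simp
      also have "\<dots> \<le> Max (F k)" using *(1)[of k] by simp
      also have "\<dots> < Min (F (Suc k))" using *(1)[of k] by simp
      finally show ?thesis .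
    qed (use * in simp)
  qed simp
  have "Max (F (s k)) < Min (F (s (Suc k)))" for k using lt strict_monoD[OF assms(2) lessI] by blast
  with * show ?thesis
    unfolding block_basis_of_1_averages_def
    by (intro exI[of _ "lam \<circ> s"] exI[of _ "F \<circ> s"]) (simp only: o_apply, blast)
qed

lemma block_basis_of_1_averages_subsequence:
  assumes "block_basis_of_1_averages (x \<circ> r) y" "strict_mono r"
  shows "block_basis_of_1_averages x y"
proof -
  obtain lam F where *: "\<And>k. lam k > (0 :: real) \<and> finite (F k) \<and> F k \<noteq> {} \<and> Max (F k) < Min (F (Suc k))"
    "\<And>k. y k = lam k *\<^sub>R (\<Sum>n\<in>F k. (x \<circ> r) n)"
    using assms(1) unfolding block_basis_of_1_averages_def by blast
  have mono: "mono r" using assms(2) by (rule strict_mono_mono)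
  have "Max (r ` F k) < Min (r ` F (Suc k))" for k
  proof -
    have "Max (r ` F k) = r (Max (F k))" "Min (r ` F (Suc k)) = r (Min (F (Suc k)))"
      using mono_Max_commute[OF mono] mono_Min_commute[OF mono] *(1) by simp_all
    then show ?thesis using *(1)[of k] assms(2) by (simp add: strict_mono_less)
  qed
  moreover have "(\<Sum>n\<in>r ` F k. x n) = (\<Sum>n\<in>F k. (x \<circ> r) n)" for k
    using strict_mono_imp_inj_on[OF assms(2)] by (intro sum.reindex) (auto simp: inj_on_def)
  ultimately show ?thesis
    unfolding block_basis_of_1_averages_def using *
    by (intro exI[of _ lam] exI[of _ "\<lambda>k. r ` F k"]) auto
qed

subsection \<open>Dense images of the finitely supported sequences\<close>

text \<open>Tychonoff's theorem makes the cube compact for pointwise convergence; a countable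
  product of lines is first countable, so the cube is also sequentially compact.\<close>

lemma pointwise_convergent_subsequence:
  fixes u :: "nat \<Rightarrow> nat \<Rightarrow> real"
  assumes "\<And>n i. \<bar>u n i\<bar> \<le> R"
  obtains s x where "strict_mono s" "\<And>i. (\<lambda>n. u (s n) i) \<longlonglongrightarrow> x i"
proof -
  let ?K = "PiE UNIV (\<lambda>_ :: nat. {-R..R})"
  have "compactin (product_topology (\<lambda>_. euclideanreal) UNIV) ?K"
    by (subst compactin_PiE) auto
  then have "compact ?K" by (simp add: euclidean_product_topology)
  then have "seq_compact ?K" by (rule compact_imp_seq_compact)
  moreover have "\<forall>n. u n \<in> ?K" using assms by (auto simp: abs_le_iff minus_le_iff)
  ultimately obtain x s where s: "strict_mono s" "(u \<circ> s) \<longlonglongrightarrow> x" by (rule seq_compactE) blast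
  have "(\<lambda>n. u (s n) i) \<longlonglongrightarrow> x i" for i
  proof -
    have "continuous_on UNIV (\<lambda>f :: nat \<Rightarrow> real. f i)" by (rule continuous_on_product_coordinates)
    from continuous_on_tendsto_compose[OF this s(2)] show ?thesis by (simp add: o_def)
  qed
  with s(1) that show thesis by blast
qed

definition tail :: "nat \<Rightarrow> (nat \<Rightarrow> real) \<Rightarrow> nat \<Rightarrow> real" where
  "tail m u i = (if i < m then 0 else u i)"

lemma lincomb_head_tail:
  assumes "finitely_supported u"
  shows "lincomb t u = (\<Sum>i<m. u i *\<^sub>R t i) + lincomb t (tail m u)"
proof -
  let ?h = "\<lambda>i. if i < m then u i else 0"
  have "finitely_supported ?h" "finitely_supported (tail m u)"
    using assms by (auto elim!: finitely_supported_mono simp: tail_def)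
  then have "lincomb t (\<lambda>i. ?h i + tail m u i) = lincomb t ?h + lincomb t (tail m u)"
    by (rule lincomb_add)
  moreover have "(\<lambda>i. ?h i + tail m u i) = u" by (auto simp: tail_def)
  moreover have "lincomb t ?h = (\<Sum>i<m. u i *\<^sub>R t i)" by (subst lincomb_eq_lessThan[of m]) auto
  ultimately show ?thesis by simp
qed

lemma tail_finitely_supported: "finitely_supported u \<Longrightarrow> finitely_supported (tail m u)"
  by (erule finitely_supported_mono) (simp add: tail_def)

lemma schreier_norm_tail_le: "finitely_supported u \<Longrightarrow> schreier_norm (tail m u) \<le> schreier_norm u"
  by (rule schreier_norm_mono) (auto simp: tail_def)

text \<open>A strengthening of weak nullness to sums of arbitrary length. The norm bound
  \<open>B\<close> is present because a functional is compared with members of a countable dense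
  family, and the error of that comparison is proportional to the norm.\<close>

definition weakly_null_sums :: "(nat \<Rightarrow> 'a::real_normed_vector) \<Rightarrow> bool" where
  "weakly_null_sums y \<longleftrightarrow> (\<forall>f :: 'a \<Rightarrow> real. \<forall>B e. bounded_linear f \<longrightarrow> e > 0 \<longrightarrow>
    (\<exists>k. \<forall>c F. 0 \<le> c \<longrightarrow> c \<le> 1 \<longrightarrow> finite F \<longrightarrow> F \<subseteq> {k..} \<longrightarrow> norm (c *\<^sub>R (\<Sum>n\<in>F. y n)) \<le> B \<longrightarrow>
      \<bar>f (c *\<^sub>R (\<Sum>n\<in>F. y n))\<bar> \<le> e))"

text \<open>Intermediate values are allowed so that the cutoffs with a fixed \<open>p\<close> and
  arbitrary \<open>q\<close> form a convex set.\<close>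

definition cutoff :: "nat \<Rightarrow> nat \<Rightarrow> (nat \<Rightarrow> real) \<Rightarrow> bool" where
  "cutoff p q \<phi> \<longleftrightarrow> (\<forall>i. 0 \<le> \<phi> i \<and> \<phi> i \<le> 1) \<and> (\<forall>i<p. \<phi> i = 1) \<and> (\<forall>i\<ge>q. \<phi> i = 0)"

lemma cutoff_indicator: "p \<le> q \<Longrightarrow> cutoff p q (\<lambda>i. if i < q then 1 else 0)"
  by (auto simp: cutoff_def)

lemma cutoff_mono: "cutoff p q \<phi> \<Longrightarrow> q \<le> q' \<Longrightarrow> cutoff p q' \<phi>"
  by (auto simp: cutoff_def)

lemma cutoff_convex:
  assumes "cutoff p q \<phi>" "cutoff p q' \<psi>" "0 \<le> a" "0 \<le> b" "a + b = 1"
  shows "cutoff p (max q q') (\<lambda>i. a * \<phi> i + b * \<psi> i)"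
  using assms convex_bound_le[of _ 1 _ a b] by (auto simp: cutoff_def)

text \<open>What is kept of a quotient map: \<open>t i\<close> stands for the image of the
  \<open>i\<close>-th unit vector, and \<open>lift\<close> says that the image of the ball of radius
  \<open>M * norm y\<close> comes arbitrarily close to \<open>y\<close>. The norm bound does not
  depend on the accuracy \<open>e\<close>.\<close>

locale schreier_dense_range =
  fixes t :: "nat \<Rightarrow> 'b::real_normed_vector" and C M :: real
  assumes C: "finitely_supported u \<Longrightarrow> norm (lincomb t u) \<le> C * schreier_norm u"
    and C_pos: "C > 0" and M_pos: "M > 0"
    and lift: "e > 0 \<Longrightarrow> \<exists>u. finitely_supported u \<and> schreier_norm u \<le> M * norm y \<and> norm (lincomb t u - y) < e"
begin

text \<open>Composing \<open>f\<close> with \<open>lincomb t\<close> gives a bounded functional on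
  the finitely supported sequences, to which the shrinking property applies.\<close>

lemma functional_tail:
  assumes "bounded_linear f" "e > 0"
  obtains m where "\<And>u. finitely_supported u \<Longrightarrow> \<bar>lincomb (\<lambda>i. f (t i)) (tail m u)\<bar> \<le> e * schreier_norm u"
proof -
  interpret f: bounded_linear f by fact
  obtain K where K: "\<And>x. norm (f x) \<le> norm x * K" "K > 0" using f.pos_bounded by blast
  have *: "\<bar>lincomb (\<lambda>i. f (t i)) u\<bar> \<le> (C * K) * schreier_norm u" if "finitely_supported u" for u
  proof -
    have "\<bar>lincomb (\<lambda>i. f (t i)) u\<bar> = norm (f (lincomb t u))"
      using linear_lincomb[OF f.linear] by simp
    also have "\<dots> \<le> norm (lincomb t u) * K" by (rule K(1))
    also have "\<dots> \<le> (C * schreier_norm u) * K" using C[OF that] K(2) by (intro mult_right_mono) auto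
    finally show ?thesis by (simp add: mult_ac)
  qed
  obtain m where m: "\<And>u. finitely_supported u \<Longrightarrow> \<forall>i<m. u i = 0 \<Longrightarrow>
    \<bar>lincomb (\<lambda>i. f (t i)) u\<bar> \<le> e * schreier_norm u" 
    using schreier_shrinking[of "\<lambda>i. f (t i)" "C * K" e] * assms(2) by blast
  have "\<bar>lincomb (\<lambda>i. f (t i)) (tail m u)\<bar> \<le> e * schreier_norm u" if "finitely_supported u" for u
  proof -
    have "\<bar>lincomb (\<lambda>i. f (t i)) (tail m u)\<bar> \<le> e * schreier_norm (tail m u)"
      using that by (intro m tail_finitely_supported) (simp_all add: tail_def)
    also have "\<dots> \<le> e * schreier_norm u"
      using assms(2) that by (intro mult_left_mono schreier_norm_tail_le) auto
    finally show ?thesis .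
  qed
  with that show thesis by blast
qed

text \<open>Up to a small tail, a functional is determined by its values at finitely many
  \<open>t i\<close>, and these may be rounded to rationals. Each code \<open>(l, k)\<close> thus
  describes a class \<open>A (l, k)\<close> of functionals that are close to one another, and
  choosing one member per nonempty class gives a countable dense family.\<close>

lemma dual_separable:
  obtains d :: "nat \<Rightarrow> 'b \<Rightarrow> real" where "\<And>n. bounded_linear (d n)"
    "\<And>f e. bounded_linear f \<Longrightarrow> e > 0 \<Longrightarrow> \<exists>n. \<forall>y. \<bar>f y - d n y\<bar> \<le> e * norm y"
proof -
  define A where "A = (\<lambda>(l :: rat list, k :: nat) (f :: 'b \<Rightarrow> real). bounded_linear f \<and>
    (\<forall>i<length l. \<bar>f (t i) - of_rat (l ! i)\<bar> \<le> 1 / (real (Suc k) * (real (length l) + 1))) \<and>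
    (\<forall>u. finitely_supported u \<longrightarrow>
      \<bar>lincomb (\<lambda>i. f (t i)) (tail (length l) u)\<bar> \<le> (1 / real (Suc k)) * schreier_norm u))"
  \<comment> \<open>Codes of empty classes get the zero functional, so that every \<open>h p\<close>
    is bounded and linear.\<close>
  define h where "h = (\<lambda>p. if \<exists>f. A p f then SOME f. A p f else (\<lambda>_. 0))"
  have h: "A p (h p)" if "A p f" for p f unfolding h_def using that someI[of "A p" f] by auto
  have h_bl: "bounded_linear (h p)" for p
  proof (cases "\<exists>f. A p f")
    case True then show ?thesis using h by (cases p) (auto simp: A_def)
  qed (auto simp: h_def)
  define d where "d = (\<lambda>n. h (from_nat n))"
  have "\<exists>n. \<forall>y. \<bar>f y - d n y\<bar> \<le> e * norm y" if f: "bounded_linear f" and e: "e > 0" for f e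
  proof -
    \<comment> \<open>Members of one class differ on a lift by at most
      \<open>4 / real (Suc k)\<close> times its Schreier norm: two units from the head and one from
      each of the two tails. Passing from lifts to vectors costs the factor
      \<open>M\<close>.\<close>
    obtain k :: nat where k: "real k > 4 * M / e" using reals_Archimedean2 by blast
    have kM: "4 * M / real (Suc k) \<le> e" using k e by (simp add: field_simps)
    obtain m where m: "\<And>u. finitely_supported u \<Longrightarrow>
        \<bar>lincomb (\<lambda>i. f (t i)) (tail m u)\<bar> \<le> (1 / real (Suc k)) * schreier_norm u"
      using functional_tail[OF f, of "1 / real (Suc k)"] by auto
    \<comment> \<open>The rounding error is shared among the \<open>m\<close> head coordinates;
      \<open>real m + 1\<close> also covers \<open>m = 0\<close>.\<close>
    define \<eta> where "\<eta> = 1 / (real (Suc k) * (real m + 1))"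
    have "\<eta> > 0" by (simp add: \<eta>_def)
    have "\<exists>r. \<bar>f (t i) - of_rat r\<bar> \<le> \<eta>" for i
    proof -
      obtain r where "f (t i) < of_rat r" "of_rat r < f (t i) + \<eta>"
        using of_rat_dense[of "f (t i)" "f (t i) + \<eta>"] \<open>\<eta> > 0\<close> by auto
      then show ?thesis by (intro exI[of _ r]) auto
    qed
    then obtain r where r: "\<And>i. \<bar>f (t i) - of_rat (r i)\<bar> \<le> \<eta>" by metis
    define l where "l = map r [0..<m]"
    have l: "length l = m" "\<And>i. i < m \<Longrightarrow> l ! i = r i" by (auto simp: l_def)
    have "A (l, k) f" using f r m by (auto simp: A_def l \<eta>_def)
    then have A: "A (l, k) (h (l, k))" by (rule h)
    define f' where "f' = h (l, k)"
    have f': "bounded_linear f'" "\<And>i. i < m \<Longrightarrow> \<bar>f' (t i) - of_rat (r i)\<bar> \<le> \<eta>"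
      "\<And>u. finitely_supported u \<Longrightarrow>
        \<bar>lincomb (\<lambda>i. f' (t i)) (tail m u)\<bar> \<le> (1 / real (Suc k)) * schreier_norm u"
      using A by (auto simp: A_def l \<eta>_def f'_def)
    interpret f: bounded_linear f by fact
    interpret f': bounded_linear f' by fact
    have c00: "\<bar>f (lincomb t u) - f' (lincomb t u)\<bar> \<le> (4 / real (Suc k)) * schreier_norm u"
      if u: "finitely_supported u" for u
    proof -
      have head: "\<bar>(\<Sum>i<m. u i * f (t i)) - (\<Sum>i<m. u i * f' (t i))\<bar> \<le> (2 / real (Suc k)) * schreier_norm u"
      proof -
        have "\<bar>(\<Sum>i<m. u i * f (t i)) - (\<Sum>i<m. u i * f' (t i))\<bar> = \<bar>\<Sum>i<m. u i * (f (t i) - f' (t i))\<bar>"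
          by (simp add: sum_subtractf right_diff_distrib)
        also have "\<dots> \<le> (\<Sum>i<m. schreier_norm u * (2 * \<eta>))"
        proof (rule order_trans[OF sum_abs], rule sum_mono)
          fix i assume "i \<in> {..<m}"
          then have "\<bar>f (t i) - f' (t i)\<bar> \<le> 2 * \<eta>" using r[of i] f'(2)[of i] by simp
          then show "\<bar>u i * (f (t i) - f' (t i))\<bar> \<le> schreier_norm u * (2 * \<eta>)"
            unfolding abs_mult by (intro mult_mono abs_le_schreier_norm schreier_norm_nonneg u) auto
        qed
        also have "\<dots> = (real m * \<eta>) * (2 * schreier_norm u)" by simp
        also have "\<dots> \<le> ((real m + 1) * \<eta>) * (2 * schreier_norm u)"
          using schreier_norm_nonneg[OF u] \<open>\<eta> > 0\<close> by (intro mult_right_mono) auto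
        also have "(real m + 1) * \<eta> = 1 / real (Suc k)"
          using of_nat_0_le_iff[of m] unfolding \<eta>_def by (simp add: divide_simps del: of_nat_Suc)
        finally show ?thesis by simp
      qed
      have "f (lincomb t u) = (\<Sum>i<m. u i * f (t i)) + lincomb (\<lambda>i. f (t i)) (tail m u)"
        "f' (lincomb t u) = (\<Sum>i<m. u i * f' (t i)) + lincomb (\<lambda>i. f' (t i)) (tail m u)"
        using linear_lincomb[OF f.linear, of t u] linear_lincomb[OF f'.linear, of t u]
          lincomb_head_tail[OF u, of "\<lambda>i. f (t i)" m] lincomb_head_tail[OF u, of "\<lambda>i. f' (t i)" m] by simp_all
      moreover have "(4 / real (Suc k)) * schreier_norm u = (2 / real (Suc k)) * schreier_norm u +
          (1 / real (Suc k)) * schreier_norm u + (1 / real (Suc k)) * schreier_norm u"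
        unfolding distrib_right[symmetric] add_divide_distrib[symmetric] by simp
      ultimately show ?thesis using head m[OF u] f'(3)[OF u] by linarith
    qed
    have "\<bar>f y - f' y\<bar> \<le> e * norm y" for y
    proof (rule field_le_epsilon)
      fix \<epsilon> :: real assume \<epsilon>: "\<epsilon> > 0"
      obtain K where K: "\<And>x. norm (f x) \<le> norm x * K" "K > 0" using f.pos_bounded by blast
      obtain K' where K': "\<And>x. norm (f' x) \<le> norm x * K'" "K' > 0" using f'.pos_bounded by blast
      obtain u where u: "finitely_supported u" "schreier_norm u \<le> M * norm y"
        "norm (lincomb t u - y) < \<epsilon> / (K + K')" using lift[of "\<epsilon> / (K + K')" y] \<epsilon> K(2) K'(2) by auto
      have "\<bar>f (lincomb t u - y)\<bar> + \<bar>f' (lincomb t u - y)\<bar> \<le> norm (lincomb t u - y) * (K + K')"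
        using K(1)[of "lincomb t u - y"] K'(1)[of "lincomb t u - y"] by (simp add: distrib_left)
      also have "\<dots> \<le> \<epsilon>" using u(3) K(2) K'(2) by (simp add: pos_less_divide_eq)
      finally have 1: "\<bar>f (lincomb t u - y)\<bar> + \<bar>f' (lincomb t u - y)\<bar> \<le> \<epsilon>" .
      have "\<bar>f (lincomb t u) - f' (lincomb t u)\<bar> \<le> (4 / real (Suc k)) * (M * norm y)"
        using c00[OF u(1)] u(2) by (elim order_trans) (intro mult_left_mono, auto)
      also have "\<dots> = (4 * M / real (Suc k)) * norm y" by simp
      also have "\<dots> \<le> e * norm y" using kM by (intro mult_right_mono) auto
      finally show "\<bar>f y - f' y\<bar> \<le> e * norm y + \<epsilon>" using 1 by (simp add: f.diff f'.diff)
    qed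
    then show ?thesis unfolding d_def f'_def by (intro exI[of _ "to_nat (l, k)"]) simp
  qed
  with that[of d] h_bl show thesis by (simp add: d_def)
qed

text \<open>A diagonal choice makes the \<open>n\<close>-th term smaller than
  \<open>(1/2) ^ n\<close> on the first \<open>n + 1\<close> functionals of a dense family. Sums
  starting far out are then small on each of them by a geometric series, and density transfers this
  to every \<open>f\<close> on vectors of norm at most \<open>B\<close>.\<close>

lemma weakly_null_sums_subsequence:
  assumes "weakly_null (y :: nat \<Rightarrow> 'b)"
  obtains r :: "nat \<Rightarrow> nat" where "strict_mono r" "weakly_null_sums (y \<circ> r)"
proof -
  obtain d :: "nat \<Rightarrow> 'b \<Rightarrow> real" where d: "\<And>n. bounded_linear (d n)"
    "\<And>f e. bounded_linear f \<Longrightarrow> e > 0 \<Longrightarrow> \<exists>n. \<forall>y. \<bar>f y - d n y\<bar> \<le> e * norm y"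
    using dual_separable by blast
  have ev: "\<forall>\<^sub>F m in sequentially. \<forall>i\<in>{..n}. \<bar>d i (y m)\<bar> < (1/2) ^ n" for n
  proof (intro eventually_ball_finite ballI)
    fix i
    show "\<forall>\<^sub>F m in sequentially. \<bar>d i (y m)\<bar> < (1/2) ^ n"
      using tendstoD[OF weakly_nullD[OF assms d(1)], of "(1/2) ^ n" i] by simp
  qed simp
  have ex: "\<exists>m>k. \<forall>i\<le>n. \<bar>d i (y m)\<bar> < (1/2) ^ n" for n k
  proof -
    have "\<forall>\<^sub>F m in sequentially. m > k \<and> (\<forall>i\<in>{..n}. \<bar>d i (y m)\<bar> < (1/2) ^ n)"
      using ev[of n] eventually_gt_at_top[of k] by eventually_elim auto
    from eventually_happens'[OF sequentially_bot this] show ?thesis by auto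
  qed
  have "\<exists>r. \<forall>n. (\<forall>i\<le>n. \<bar>d i (y (r n))\<bar> < (1/2) ^ n) \<and> r n < r (Suc n)"
    by (rule dependent_nat_choice) (use ex in blast)+
  then obtain r where r: "\<And>n i. i \<le> n \<Longrightarrow> \<bar>d i (y (r n))\<bar> < (1/2) ^ n" "\<And>n. r n < r (Suc n)" by blast
  have "\<exists>k. \<forall>c F. 0 \<le> c \<longrightarrow> c \<le> 1 \<longrightarrow> finite F \<longrightarrow> F \<subseteq> {k..} \<longrightarrow> norm (c *\<^sub>R (\<Sum>n\<in>F. (y \<circ> r) n)) \<le> B \<longrightarrow>
      \<bar>f (c *\<^sub>R (\<Sum>n\<in>F. (y \<circ> r) n))\<bar> \<le> e" if f: "bounded_linear f" and e: "e > 0" for f :: "'b \<Rightarrow> real" and B e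
  proof -
    have "e / (2 * (\<bar>B\<bar> + 1)) > 0" using e by simp
    then obtain j where j: "\<And>z. \<bar>f z - d j z\<bar> \<le> e / (2 * (\<bar>B\<bar> + 1)) * norm z" using d(2)[OF f] by blast
    obtain k0 where k0: "(1/2) ^ k0 < e / 4" using real_arch_pow_inv[of "e / 4" "1/2"] e by auto
    define k where "k = max j k0"
    have "(1/2 :: real) ^ k \<le> (1/2) ^ k0" by (intro power_decreasing) (auto simp: k_def)
    then have k: "j \<le> k" "(1/2) ^ k < e / 4" using k0 by (simp add: k_def, linarith)
    interpret d: bounded_linear "d j" by (rule d)
    have "\<bar>f (c *\<^sub>R (\<Sum>n\<in>F. (y \<circ> r) n))\<bar> \<le> e"
      if c: "0 \<le> c" "c \<le> 1" and F: "finite F" "F \<subseteq> {k..}" and B: "norm (c *\<^sub>R (\<Sum>n\<in>F. (y \<circ> r) n)) \<le> B" for c F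
    proof -
      let ?z = "c *\<^sub>R (\<Sum>n\<in>F. (y \<circ> r) n)"
      have "\<bar>d j ?z\<bar> = c * \<bar>\<Sum>n\<in>F. d j (y (r n))\<bar>" using c by (simp add: d.scaleR d.sum abs_mult)
      also have "\<dots> \<le> \<bar>\<Sum>n\<in>F. d j (y (r n))\<bar>" using c by (simp add: mult_left_le_one_le)
      also have "\<dots> \<le> (\<Sum>n\<in>F. \<bar>d j (y (r n))\<bar>)" by (rule sum_abs)
      also have "\<dots> \<le> (\<Sum>n\<in>F. (1/2) ^ n)"
        using F(2) k(1) by (intro sum_mono less_imp_le[OF r(1)]) auto
      also have "\<dots> \<le> 2 * (1/2) ^ k" using F by (rule sum_half_powers_le)
      also have "\<dots> \<le> e / 2" using k(2) by simp
      finally have 1: "\<bar>d j ?z\<bar> \<le> e / 2" .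
      have "e / (2 * (\<bar>B\<bar> + 1)) * norm ?z \<le> e / (2 * (\<bar>B\<bar> + 1)) * (\<bar>B\<bar> + 1)"
        using B e by (intro mult_left_mono) auto
      also have "\<dots> = e / 2"
      proof -
        have "\<bar>B\<bar> + 1 > 0" by simp
        then show ?thesis by (simp add: field_simps)
      qed
      finally have "\<bar>f ?z - d j ?z\<bar> \<le> e / 2" using j[of ?z] by linarith
      with 1 show ?thesis by linarith
    qed
    then show ?thesis by blast
  qed
  then have "weakly_null_sums (y \<circ> r)" unfolding weakly_null_sums_def by blast
  moreover have "strict_mono r" using r(2) by (simp add: strict_mono_Suc_iff)
  ultimately show thesis using that by blast
qed


text \<open>A lift \<open>u\<close> of \<open>c *\<^sub>R (\<Sum>n\<in>F. y n)\<close> can be cut, inside any long enough gap of \<open>F\<close>, into lifts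
  of the two partial sums. Sharp cuts fail: the truncations of a pointwise limit of such lifts
  converge only weakly in the range. Mazur's theorem provides a convex combination of truncations
  that converges in norm, hence the gradual cutoff \<open>\<phi>\<close>.\<close>

lemma gap_cutoff:
  assumes ws: "weakly_null_sums y" and e: "e > 0"
  obtains q where "p < q"
    "\<forall>u c F. finitely_supported u \<longrightarrow> schreier_norm u \<le> R \<longrightarrow> 0 \<le> c \<longrightarrow> c \<le> 1 \<longrightarrow> finite F \<longrightarrow>
      F \<inter> {p..<q} = {} \<longrightarrow> norm (lincomb t u - c *\<^sub>R (\<Sum>n\<in>F. y n)) < 1 / (real q + 1) \<longrightarrow>
      (\<exists>\<phi>. cutoff p q \<phi> \<and> norm (lincomb t (\<lambda>i. \<phi> i * u i) - c *\<^sub>R (\<Sum>n\<in>F \<inter> {..<p}. y n)) < e)"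
proof (rule ccontr)
  assume contr: "\<not> thesis"
  define P where "P = (\<lambda>n u c F. finitely_supported u \<and> schreier_norm u \<le> R \<and> 0 \<le> c \<and> c \<le> 1 \<and> finite F \<and>
      F \<inter> {p..<p + Suc n} = {} \<and> norm (lincomb t u - c *\<^sub>R (\<Sum>n\<in>F. y n)) < 1 / (real (p + Suc n) + 1) \<and>
      \<not> (\<exists>\<phi>. cutoff p (p + Suc n) \<phi> \<and>
        norm (lincomb t (\<lambda>i. \<phi> i * u i) - c *\<^sub>R (\<Sum>n\<in>F \<inter> {..<p}. y n)) < e))"
  have "\<exists>u c F. P n u c F" for n
  proof (rule ccontr)
    assume "\<not> ?thesis"
    then have "\<forall>u c F. finitely_supported u \<longrightarrow> schreier_norm u \<le> R \<longrightarrow> 0 \<le> c \<longrightarrow> c \<le> 1 \<longrightarrow> finite F \<longrightarrow>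
      F \<inter> {p..<p + Suc n} = {} \<longrightarrow>
      norm (lincomb t u - c *\<^sub>R (\<Sum>n\<in>F. y n)) < 1 / (real (p + Suc n) + 1) \<longrightarrow>
      (\<exists>\<phi>. cutoff p (p + Suc n) \<phi> \<and>
        norm (lincomb t (\<lambda>i. \<phi> i * u i) - c *\<^sub>R (\<Sum>n\<in>F \<inter> {..<p}. y n)) < e)"
      unfolding P_def by blast
    then have thesis by (rule that[rotated]) simp
    with contr show False by contradiction
  qed
  then obtain u c F where P: "\<And>n. P n (u n) (c n) (F n)" by metis
  have u: "finitely_supported (u n)" "schreier_norm (u n) \<le> R"
    and c: "0 \<le> c n" "c n \<le> 1"
    and F: "finite (F n)" "F n \<inter> {p..<p + Suc n} = {}"
    and close: "norm (lincomb t (u n) - c n *\<^sub>R (\<Sum>n\<in>F n. y n)) < 1 / (real (p + Suc n) + 1)" for n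
    using P[of n] unfolding P_def by blast+
  have no: "e \<le> norm (lincomb t (\<lambda>i. \<phi> i * u n i) - c n *\<^sub>R (\<Sum>n\<in>F n \<inter> {..<p}. y n))"
    if "cutoff p (p + Suc n) \<phi>" for n \<phi>
    using P[of n] that unfolding P_def by (meson not_le)
  \<comment> \<open>The gap splits the sum: \<open>z n\<close> ranges over a compact set, while the
    indices in \<open>w n\<close> move off to infinity, where \<open>weakly_null_sums\<close>
    applies.\<close>
  define z where "z = (\<lambda>n. c n *\<^sub>R (\<Sum>n\<in>F n \<inter> {..<p}. y n))"
  define w where "w = (\<lambda>n. c n *\<^sub>R (\<Sum>n\<in>F n \<inter> {p + Suc n..}. y n))"
  have zw: "z n + w n = c n *\<^sub>R (\<Sum>n\<in>F n. y n)" for n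
  proof -
    have "F n = (F n \<inter> {..<p}) \<union> (F n \<inter> {p + Suc n..})" using F(2)[of n] by (auto simp: not_less)
    then have "(\<Sum>n\<in>F n. y n) = (\<Sum>n\<in>F n \<inter> {..<p}. y n) + (\<Sum>n\<in>F n \<inter> {p + Suc n..}. y n)"
      using F(1)[of n] by (subst sum.union_disjoint[symmetric]) auto
    then show ?thesis by (simp add: z_def w_def scaleR_right_distrib)
  qed
  have z_box: "z n \<in> box_sums y p" for n
  proof -
    have "z n = (\<Sum>i\<in>F n \<inter> {..<p}. c n *\<^sub>R y i)" by (simp add: z_def scaleR_sum_right)
    also have "\<dots> \<in> box_sums y p" using c by (intro sum_in_box_sums) auto
    finally show ?thesis .
  qed
  have u_abs: "\<bar>u n i\<bar> \<le> R" for n i using abs_le_schreier_norm[OF u(1)] u(2) order_trans by blast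
  obtain s1 x where s1: "strict_mono s1" "\<And>i. (\<lambda>n. u (s1 n) i) \<longlonglongrightarrow> x i"
    using pointwise_convergent_subsequence[of u R] u_abs by blast
  obtain z' s2 where s2: "strict_mono s2" "((z \<circ> s1) \<circ> s2) \<longlonglongrightarrow> z'"
    using compact_box_sums[of y p] z_box unfolding compact_def by (metis comp_apply)
  define s where "s = s1 \<circ> s2"
  have s: "strict_mono s" using s1(1) s2(1) by (simp add: s_def strict_mono_o)
  have s_ge: "n \<le> s n" for n using s by (rule seq_suble)
  have ux: "(\<lambda>n. u (s n) i) \<longlonglongrightarrow> x i" for i
    using LIMSEQ_subseq_LIMSEQ[OF s1(2) s2(1)] by (simp add: o_def s_def)
  have zz: "(\<lambda>n. z (s n)) \<longlonglongrightarrow> z'" using s2(2) by (simp add: o_def s_def)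
  \<comment> \<open>The pointwise limit \<open>x\<close> need not be finitely supported, so only its
    cutoffs are mapped into the range.\<close>
  define K where "K = {lincomb t (\<lambda>i. \<phi> i * x i) - z' | \<phi> q. cutoff p q \<phi>}"
  have cut_fs: "finitely_supported (\<lambda>i. \<phi> i * a i)" if "cutoff p q \<phi>" for q \<phi> a
    using that by (intro finitely_supported_bounded[of q]) (auto simp: cutoff_def)
  \<comment> \<open>A cutoff that succeeds for the limit involves finitely many coordinates, so by
    pointwise convergence it succeeds for \<open>u (s n)\<close> with \<open>n\<close> large,
    contrary to \<open>no\<close>.\<close>
  have K_far: "e / 2 \<le> norm k" if k: "k \<in> K" for k
  proof (rule ccontr)
    assume "\<not> ?thesis"
    then obtain \<phi> q where \<phi>: "cutoff p q \<phi>" "norm (lincomb t (\<lambda>i. \<phi> i * x i) - z') < e / 2"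
      using k by (auto simp: K_def)
    have sum_eq: "lincomb t (\<lambda>i. \<phi> i * a i) = (\<Sum>i<q. (\<phi> i * a i) *\<^sub>R t i)" for a
      using \<phi>(1) by (intro lincomb_eq_lessThan) (auto simp: cutoff_def)
    have "(\<lambda>n. norm (lincomb t (\<lambda>i. \<phi> i * u (s n) i) - z (s n)))
        \<longlonglongrightarrow> norm (lincomb t (\<lambda>i. \<phi> i * x i) - z')"
      unfolding sum_eq by (intro tendsto_intros ux zz)
    then have "\<forall>\<^sub>F n in sequentially. norm (lincomb t (\<lambda>i. \<phi> i * u (s n) i) - z (s n)) < e / 2"
      using \<phi>(2) by (rule order_tendstoD)
    with eventually_ge_at_top[of q]
    have "\<forall>\<^sub>F n in sequentially. q \<le> n \<and> norm (lincomb t (\<lambda>i. \<phi> i * u (s n) i) - z (s n)) < e / 2"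
      by eventually_elim simp
    from eventually_happens'[OF sequentially_bot this] obtain n
      where n: "q \<le> n" "norm (lincomb t (\<lambda>i. \<phi> i * u (s n) i) - z (s n)) < e / 2" by blast
    have "cutoff p (p + Suc (s n)) \<phi>" using \<phi>(1) n(1) s_ge[of n] by (intro cutoff_mono[OF \<phi>(1)]) simp
    from no[OF this] n(2) e show False by (simp add: z_def)
  qed
  have conv: "convex K"
  proof (rule convexI)
    fix k l and a b :: real assume kl: "k \<in> K" "l \<in> K" and ab: "0 \<le> a" "0 \<le> b" "a + b = 1"
    obtain \<phi> q \<psi> q' where \<phi>: "cutoff p q \<phi>" "k = lincomb t (\<lambda>i. \<phi> i * x i) - z'"
      and \<psi>: "cutoff p q' \<psi>" "l = lincomb t (\<lambda>i. \<psi> i * x i) - z'" using kl by (auto simp: K_def)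
    have "(\<lambda>i. (a * \<phi> i + b * \<psi> i) * x i) = (\<lambda>i. a * (\<phi> i * x i) + b * (\<psi> i * x i))"
      by (auto simp: algebra_simps)
    then have "lincomb t (\<lambda>i. (a * \<phi> i + b * \<psi> i) * x i) =
        a *\<^sub>R lincomb t (\<lambda>i. \<phi> i * x i) + b *\<^sub>R lincomb t (\<lambda>i. \<psi> i * x i)"
      using cut_fs[OF \<phi>(1)] cut_fs[OF \<psi>(1)]
      by (simp add: lincomb_add lincomb_scale finitely_supported_mult)
    moreover have "a *\<^sub>R k + b *\<^sub>R l =
        (a *\<^sub>R lincomb t (\<lambda>i. \<phi> i * x i) + b *\<^sub>R lincomb t (\<lambda>i. \<psi> i * x i)) - (a + b) *\<^sub>R z'"
      by (simp add: \<phi> \<psi> algebra_simps)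
    ultimately have "a *\<^sub>R k + b *\<^sub>R l = lincomb t (\<lambda>i. (a * \<phi> i + b * \<psi> i) * x i) - z'"
      using ab by simp
    with cutoff_convex[OF \<phi>(1) \<psi>(1) ab] show "a *\<^sub>R k + b *\<^sub>R l \<in> K" unfolding K_def
      by (intro CollectI exI[of _ "\<lambda>i. a * \<phi> i + b * \<psi> i"] exI[of _ "max q q'"]) simp
  qed
  have ne: "K \<noteq> {}" using cutoff_indicator[of p p] by (auto simp: K_def)
  obtain f :: "'b \<Rightarrow> real" where f: "bounded_linear f" "\<forall>x. \<bar>f x\<bar> \<le> norm x"
    "\<forall>k\<in>K. e / 2 \<le> f k"
    using convex_away_from_zero_separation[OF conv ne K_far] by blast
  interpret f: bounded_linear f by fact
  have "R \<ge> 0" using u_abs[of 0 0] by linarith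
  \<comment> \<open>Error budget: \<open>f \<ge> e / 2\<close> on \<open>K\<close> leaves more than
    \<open>3 * e / 8\<close> for the head of \<open>u (s n)\<close> minus \<open>z (s n)\<close>.
    This difference is also at most \<open>e / 4\<close>, namely \<open>e / 8\<close> for the tail
    and \<open>e / 16\<close> each for \<open>w (s n)\<close> and the approximation error.\<close>
  obtain m0 where m0: "\<And>u. finitely_supported u \<Longrightarrow>
      \<bar>lincomb (\<lambda>i. f (t i)) (tail m0 u)\<bar> \<le> (e / (8 * (R + 1))) * schreier_norm u"
    using functional_tail[OF f(1), of "e / (8 * (R + 1))"] e \<open>R \<ge> 0\<close> by auto
  \<comment> \<open>\<open>m \<ge> p\<close> makes the sharp truncation at \<open>m\<close> one of
    the cutoffs that define \<open>K\<close>.\<close>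
  define m where "m = max p m0"
  have tail_m: "\<bar>lincomb (\<lambda>i. f (t i)) (tail m (u n))\<bar> \<le> e / 8" for n
  proof -
    have "tail m (u n) = tail m0 (tail m (u n))" by (rule ext) (auto simp: tail_def m_def)
    then have "\<bar>lincomb (\<lambda>i. f (t i)) (tail m (u n))\<bar> \<le> (e / (8 * (R + 1))) * schreier_norm (tail m (u n))"
      using m0[OF tail_finitely_supported[OF u(1)], of m n] by metis
    also have "\<dots> \<le> (e / (8 * (R + 1))) * (R + 1)"
      using schreier_norm_tail_le[OF u(1), of m n] u(2)[of n] e \<open>R \<ge> 0\<close> by (intro mult_left_mono) auto
    also have "\<dots> = e / 8" using \<open>R \<ge> 0\<close> by (simp add: field_simps)
    finally show ?thesis .
  qed
  have "lincomb t (\<lambda>i. (if i < m then 1 else 0) * x i) - z' \<in> K"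
    unfolding K_def using cutoff_indicator[of p m]
    by (intro CollectI exI[of _ "\<lambda>i. if i < m then 1 else 0"] exI[of _ m]) (simp add: m_def)
  moreover have "lincomb t (\<lambda>i. (if i < m then 1 else 0) * x i) = (\<Sum>i<m. x i *\<^sub>R t i)"
    by (subst lincomb_eq_lessThan[of m]) auto
  ultimately have fx: "e / 2 \<le> (\<Sum>i<m. x i * f (t i)) - f z'"
    using f(3) by (fastforce simp: f.diff f.sum f.scaleR)
  have "(\<lambda>n. (\<Sum>i<m. u (s n) i * f (t i)) - f (z (s n))) \<longlonglongrightarrow> (\<Sum>i<m. x i * f (t i)) - f z'"
    by (intro tendsto_intros ux f.tendsto zz)
  then have ev1: "\<forall>\<^sub>F n in sequentially. 3 * e / 8 < (\<Sum>i<m. u (s n) i * f (t i)) - f (z (s n))"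
    using fx e by (intro order_tendstoD) auto
  \<comment> \<open>\<open>weakly_null_sums\<close> asks for a norm bound: \<open>w n\<close> is the
    image of a bounded lift minus an element of a compact set, up to an error of at most 1.\<close>
  obtain B where B: "\<And>n. norm (w n) \<le> B"
  proof -
    obtain b where b: "\<And>z. z \<in> box_sums y p \<Longrightarrow> norm z \<le> b"
      using compact_imp_bounded[OF compact_box_sums] unfolding bounded_iff by blast
    have "norm (w n) \<le> C * R + b + 1" for n
    proof -
      have "w n = lincomb t (u n) - z n - (lincomb t (u n) - c n *\<^sub>R (\<Sum>n\<in>F n. y n))"
        using zw[of n] by (simp add: algebra_simps)
      then have "norm (w n) \<le> norm (lincomb t (u n)) + norm (z n) +
          norm (lincomb t (u n) - c n *\<^sub>R (\<Sum>n\<in>F n. y n))"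
        using norm_triangle_ineq4[of "lincomb t (u n) - z n" "lincomb t (u n) - c n *\<^sub>R (\<Sum>n\<in>F n. y n)"]
          norm_triangle_ineq4[of "lincomb t (u n)" "z n"] by simp
      moreover have "norm (lincomb t (u n)) \<le> C * R"
        using C[OF u(1), of n] u(2)[of n] C_pos by (meson mult_left_mono less_imp_le order_trans)
      moreover have "1 / (real (p + Suc n) + 1) \<le> 1" by simp
      ultimately show ?thesis using b[OF z_box, of n] close[of n] by linarith
    qed
    then show thesis using that by blast
  qed
  obtain k where k: "\<And>c F. 0 \<le> c \<Longrightarrow> c \<le> 1 \<Longrightarrow> finite F \<Longrightarrow> F \<subseteq> {k..} \<Longrightarrow>
      norm (c *\<^sub>R (\<Sum>n\<in>F. y n)) \<le> B \<Longrightarrow> \<bar>f (c *\<^sub>R (\<Sum>n\<in>F. y n))\<bar> \<le> e / 16"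
    using ws f(1) e unfolding weakly_null_sums_def by (metis divide_pos_pos zero_less_numeral)
  obtain N :: nat where N: "real N > 16 / e" using reals_Archimedean2 by blast
  from eventually_happens'[OF sequentially_bot eventually_conj[OF ev1 eventually_ge_at_top[of "max k N"]]]
  obtain n where n: "3 * e / 8 < (\<Sum>i<m. u (s n) i * f (t i)) - f (z (s n))" "k \<le> n" "N \<le> n" by auto
  have fw: "\<bar>f (w (s n))\<bar> \<le> e / 16"
    unfolding w_def using c F n(2) s_ge[of n] B[of "s n"] by (intro k) (auto simp: w_def)
  have "1 / (real (p + Suc (s n)) + 1) \<le> e / 16"
  proof -
    have "16 / e \<le> real (p + Suc (s n)) + 1" using N n(3) s_ge[of n] by linarith
    then show ?thesis using e by (simp add: field_simps)
  qed
  then have "\<bar>f (lincomb t (u (s n)) - (z (s n) + w (s n)))\<bar> \<le> e / 16"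
    using f(2)[rule_format, of "lincomb t (u (s n)) - (z (s n) + w (s n))"] close[of "s n"] unfolding zw by linarith
  then have "f (lincomb t (u (s n))) - f (z (s n)) \<le> e / 8"
    using fw unfolding f.diff f.add by linarith
  moreover have "f (lincomb t (u (s n))) = (\<Sum>i<m. u (s n) i * f (t i)) + lincomb (\<lambda>i. f (t i)) (tail m (u (s n)))"
    using linear_lincomb[OF f.linear, of t "u (s n)"] lincomb_head_tail[OF u(1), of "\<lambda>i. f (t i)" "s n" m] by simp
  ultimately show False using n(1) tail_m[of "s n"] e by linarith
qed

end

section \<open>Large coordinates and partitions of unity\<close>

text \<open>Any \<open>m\<close> positions from \<open>m\<close> onwards form an admissible set, so
  \<open>m\<close> large coordinates there would give a sum of at least
  \<open>real m * \<delta>\<close>, which exceeds \<open>R\<close>. At most \<open>m\<close> further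
  positions lie below \<open>m\<close>.\<close>

lemma card_large_coordinates_le:
  assumes u: "finitely_supported u" "schreier_norm u \<le> R" and "\<delta> > 0" and m: "R < real m * \<delta>"
  shows "finite {i. \<delta> < \<bar>u i\<bar>}" "card {i. \<delta> < \<bar>u i\<bar>} \<le> 2 * m"
proof -
  let ?G = "{i. \<delta> < \<bar>u i\<bar>}"
  have "?G \<subseteq> {i. u i \<noteq> 0}" using \<open>\<delta> > 0\<close> by auto
  then show fin: "finite ?G" using u(1) finite_subset unfolding finitely_supported_def by blast
  have "m > 0"
  proof (rule ccontr)
    assume "\<not> m > 0"
    then show False using m u(2) schreier_norm_nonneg[OF u(1)] by simp
  qed
  have "card (?G \<inter> {m..}) \<le> m"
  proof (rule ccontr)
    assume "\<not> ?thesis"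
    then obtain H where H: "H \<subseteq> ?G \<inter> {m..}" "card H = m" "finite H"
      using obtain_subset_with_card_n[of m "?G \<inter> {m..}"] by auto
    have "H \<noteq> {}" using H(2) \<open>m > 0\<close> by auto
    then have "m \<le> Min H" using H by (subst Min_ge_iff) auto
    then have "card H \<le> Min H + 1" using H(2) by linarith
    then have adm: "schreier_admissible H" using H(3) \<open>H \<noteq> {}\<close> unfolding schreier_admissible_def by blast
    have "real m * \<delta> = (\<Sum>i\<in>H. \<delta>)" using H(2) by simp
    also have "\<dots> \<le> (\<Sum>i\<in>H. \<bar>u i\<bar>)" using H(1) by (intro sum_mono) auto
    also have "\<dots> \<le> R" using schreier_sum_le_norm[OF u(1) adm] u(2) by linarith
    finally show False using m by simp
  qed
  moreover have "card (?G \<inter> {..<m}) \<le> m" using card_mono[of "{..<m}" "?G \<inter> {..<m}"] by auto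
  moreover have "?G = (?G \<inter> {..<m}) \<union> (?G \<inter> {m..})" by auto
  then have "card ?G \<le> card (?G \<inter> {..<m}) + card (?G \<inter> {m..})" by (metis card_Un_le)
  ultimately show "card ?G \<le> 2 * m" by linarith
qed

text \<open>The bound on finite sums ensures that adding up any selection of the pieces
  \<open>\<psi> k i * u i\<close> gives a sequence dominated by \<open>u\<close>. The last clause
  limits how many pieces one large coordinate can spoil.\<close>

definition splitting :: "(nat \<Rightarrow> nat \<Rightarrow> real) \<Rightarrow> bool" where
  "splitting \<psi> \<longleftrightarrow> (\<forall>k i. 0 \<le> \<psi> k i) \<and> (\<forall>i G. finite G \<longrightarrow> (\<Sum>k\<in>G. \<psi> k i) \<le> 1) \<and>
    (\<forall>i. \<exists>l. \<forall>k. \<psi> k i \<noteq> 0 \<longrightarrow> k = l \<or> k = Suc l)"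

text \<open>\<open>\<phi> k\<close> descends from 1 to 0 between \<open>\<tau> (2 * k)\<close> and
  \<open>\<tau> (2 * k + 1)\<close>. These ranges are disjoint, so \<open>\<phi>\<close> increases
  with \<open>k\<close> and the differences telescope. The \<open>k\<close>-th difference lives
  between \<open>\<tau> (2 * k)\<close> and \<open>\<tau> (2 * k + 3)\<close>, and a point lies in
  at most two such intervals.\<close>

lemma splitting_cutoff_differences:
  assumes \<tau>: "strict_mono \<tau>" and cut: "\<And>k. cutoff (\<tau> (2 * k)) (\<tau> (2 * k + 1)) (\<phi> k)"
  shows "splitting (\<lambda>k i. \<phi> (Suc k) i - \<phi> k i)"
proof -
  have \<phi>01: "0 \<le> \<phi> k i" "\<phi> k i \<le> 1" for k i using cut[of k] by (auto simp: cutoff_def)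
  have one: "\<phi> k i = 1" if "i < \<tau> (2 * k)" for k i using cut[of k] that by (auto simp: cutoff_def)
  have zero: "\<phi> k i = 0" if "\<tau> (2 * k + 1) \<le> i" for k i using cut[of k] that by (auto simp: cutoff_def)
  have step: "\<tau> (2 * k + 1) < \<tau> (2 * Suc k)" for k using \<tau> by (simp add: strict_mono_less)
  have mono: "\<phi> k i \<le> \<phi> (Suc k) i" for k i
    using zero[of k i] one[of i "Suc k"] step[of k] \<phi>01[of k i] \<phi>01[of "Suc k" i]
    by (cases "\<tau> (2 * k + 1) \<le> i") auto
  have sum: "(\<Sum>k\<in>G. \<phi> (Suc k) i - \<phi> k i) \<le> 1" if G: "finite G" for G i
  proof -
    obtain n where "G \<subseteq> {..<n}" using G by (auto simp: finite_nat_set_iff_bounded)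
    then have "(\<Sum>k\<in>G. \<phi> (Suc k) i - \<phi> k i) \<le> (\<Sum>k<n. \<phi> (Suc k) i - \<phi> k i)"
      using mono by (intro sum_mono2) auto
    also have "\<dots> = \<phi> n i - \<phi> 0 i" by (rule sum_lessThan_telescope)
    also have "\<dots> \<le> 1" using \<phi>01(1)[of 0 i] \<phi>01(2)[of n i] by linarith
    finally show ?thesis .
  qed
  have overlap: "\<exists>l. \<forall>k. \<phi> (Suc k) i - \<phi> k i \<noteq> 0 \<longrightarrow> k = l \<or> k = Suc l" for i
  proof -
    define l where "l = (LEAST k. i < \<tau> (2 * k + 3))"
    have "i < \<tau> (2 * i + 3)" using seq_suble[OF \<tau>, of "2 * i + 3"] by simp
    then have l: "i < \<tau> (2 * l + 3)" unfolding l_def by (rule LeastI)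
    have "k = l \<or> k = Suc l" if ne: "\<phi> (Suc k) i - \<phi> k i \<noteq> 0" for k
    proof -
      have "\<tau> (2 * k) \<le> i"
      proof (rule ccontr)
        assume "\<not> ?thesis"
        then have "i < \<tau> (2 * k)" "i < \<tau> (2 * Suc k)"
          using strict_monoD[OF \<tau>, of "2 * k" "2 * Suc k"] by auto
        then show False using ne one by simp
      qed
      with l have "\<tau> (2 * k) < \<tau> (2 * l + 3)" by linarith
      then have "2 * k < 2 * l + 3" using \<tau> by (simp add: strict_mono_less)
      moreover have "i < \<tau> (2 * k + 3)"
      proof (rule ccontr)
        assume "\<not> ?thesis"
        then have "\<tau> (2 * k + 1) \<le> i" "\<tau> (2 * Suc k + 1) \<le> i"
          using strict_monoD[OF \<tau>, of "2 * k + 1" "2 * k + 3"] by (auto simp: numeral_3_eq_3)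
        then show False using ne zero by simp
      qed
      then have "l \<le> k" unfolding l_def by (rule Least_le)
      ultimately show ?thesis by linarith
    qed
    then show ?thesis by blast
  qed
  show ?thesis unfolding splitting_def using mono sum overlap by simp
qed

section \<open>Flat lifts and the choice of the blocks\<close>

context schreier_dense_range
begin

text \<open>The tolerance \<open>\<eta>\<close> may depend on \<open>F\<close>, which is fixed
  before a lift is chosen. The errors of the pieces are summable in \<open>k\<close>, so any subset
  of pieces far enough out can be added up with small total error.\<close>

definition split_lifts :: "real \<Rightarrow> (nat \<Rightarrow> 'b) \<Rightarrow> bool" where
  "split_lifts R y \<longleftrightarrow> (\<forall>F. finite F \<longrightarrow>
    (\<exists>\<eta>>0. \<forall>u c. finitely_supported u \<longrightarrow> schreier_norm u \<le> R \<longrightarrow> 0 \<le> c \<longrightarrow> c \<le> 1 \<longrightarrow>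
      norm (lincomb t u - c *\<^sub>R (\<Sum>k\<in>F. y k)) < \<eta> \<longrightarrow>
      (\<exists>\<psi>. splitting \<psi> \<and> (\<forall>k\<in>F. norm (lincomb t (\<lambda>i. \<psi> k i * u i) - c *\<^sub>R y k) \<le> 2 * (1/2) ^ k))))"

text \<open>Iterating \<open>gap_cutoff\<close> yields consecutive gaps between
  \<open>\<tau> n\<close> and \<open>\<tau> (Suc n)\<close> with accuracy \<open>(1/2) ^ n\<close>.
  The even gaps are reserved for cutting, the selected terms sit in the odd ones. Differences of
  consecutive cutoffs isolate single terms.\<close>

lemma splitting_subsequence:
  assumes ws: "weakly_null_sums y"
  obtains r :: "nat \<Rightarrow> nat" where "strict_mono r"
    "split_lifts R (y \<circ> r)"
proof -
  define G where "G = (\<lambda>n p q. p < q \<and>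
    (\<forall>u c F. finitely_supported u \<longrightarrow> schreier_norm u \<le> R \<longrightarrow> 0 \<le> c \<longrightarrow> c \<le> 1 \<longrightarrow> finite F \<longrightarrow>
      F \<inter> {p..<q} = {} \<longrightarrow> norm (lincomb t u - c *\<^sub>R (\<Sum>n\<in>F. y n)) < 1 / (real q + 1) \<longrightarrow>
      (\<exists>\<phi>. cutoff p q \<phi> \<and> norm (lincomb t (\<lambda>i. \<phi> i * u i) - c *\<^sub>R (\<Sum>n\<in>F \<inter> {..<p}. y n)) < (1/2) ^ n)))"
  have ex: "\<exists>q. G n p q" for n p
  proof -
    have "(1/2 :: real) ^ n > 0" by simp
    then show ?thesis
      by (rule gap_cutoff[OF ws, of _ p R]) (unfold G_def, rule exI, rule conjI)
  qed
  have "\<exists>\<tau>. \<forall>n. True \<and> G n (\<tau> n) (\<tau> (Suc n))"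
    by (rule dependent_nat_choice) (use ex in blast)+
  then obtain \<tau> where \<tau>G: "\<And>n. G n (\<tau> n) (\<tau> (Suc n))" by blast
  have \<tau>: "strict_mono \<tau>" using \<tau>G by (simp add: strict_mono_Suc_iff G_def)
  \<comment> \<open>The left ends of the odd gaps lie outside all even gaps, whose right ends are
    excluded.\<close>
  define r where "r = (\<lambda>k. \<tau> (2 * k + 1))"
  have r: "strict_mono r" using \<tau> by (auto simp: strict_mono_def r_def)
  then have inj: "inj r" by (rule strict_mono_imp_inj_on)
  have "\<exists>\<eta>>0. \<forall>u c. finitely_supported u \<longrightarrow> schreier_norm u \<le> R \<longrightarrow> 0 \<le> c \<longrightarrow> c \<le> 1 \<longrightarrow>
      norm (lincomb t u - c *\<^sub>R (\<Sum>k\<in>F. y (r k))) < \<eta> \<longrightarrow>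
      (\<exists>\<psi>. splitting \<psi> \<and> (\<forall>k\<in>F. norm (lincomb t (\<lambda>i. \<psi> k i * u i) - c *\<^sub>R y (r k)) \<le> 2 * (1/2) ^ k))"
    if F: "finite F" for F
  proof -
    obtain N where N: "F \<subseteq> {..<N}" using F by (auto simp: finite_nat_set_iff_bounded)
    have sum_r: "(\<Sum>n\<in>r ` A. y n) = (\<Sum>k\<in>A. y (r k))" for A
      using inj by (subst sum.reindex) (auto intro: inj_on_subset)
    have "\<exists>\<psi>. splitting \<psi> \<and> (\<forall>k\<in>F. norm (lincomb t (\<lambda>i. \<psi> k i * u i) - c *\<^sub>R y (r k)) \<le> 2 * (1/2) ^ k)"
      if u: "finitely_supported u" "schreier_norm u \<le> R" and c: "0 \<le> c" "c \<le> 1"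
        and close: "norm (lincomb t u - c *\<^sub>R (\<Sum>k\<in>F. y (r k))) < 1 / (real (\<tau> (2 * N + 1)) + 1)" for u c
    proof -
      have "\<exists>\<phi>. cutoff (\<tau> (2 * k)) (\<tau> (2 * k + 1)) \<phi> \<and> (k \<le> N \<longrightarrow>
          norm (lincomb t (\<lambda>i. \<phi> i * u i) - c *\<^sub>R (\<Sum>j\<in>F \<inter> {..<k}. y (r j))) < (1/2) ^ (2 * k))" for k
      proof (cases "k \<le> N")
        case True
        have gap: "r ` F \<inter> {\<tau> (2 * k)..<\<tau> (Suc (2 * k))} = {}"
        proof (rule ccontr)
          assume "\<not> ?thesis"
          then obtain j where "\<tau> (2 * k) \<le> \<tau> (2 * j + 1)" "\<tau> (2 * j + 1) < \<tau> (Suc (2 * k))"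
            unfolding r_def by auto
          then have "2 * k \<le> 2 * j + 1" "2 * j + 1 < Suc (2 * k)"
            using strict_mono_less_eq[OF \<tau>] strict_mono_less[OF \<tau>] by blast+
          then show False by presburger
        qed
        have below: "r ` F \<inter> {..<\<tau> (2 * k)} = r ` (F \<inter> {..<k})"
          using strict_mono_less[OF \<tau>] by (auto simp: r_def)
        have "\<tau> (Suc (2 * k)) \<le> \<tau> (2 * N + 1)" using True strict_mono_less_eq[OF \<tau>] by simp
        then have "1 / (real (\<tau> (2 * N + 1)) + 1) \<le> 1 / (real (\<tau> (Suc (2 * k))) + 1)"
          by (intro divide_left_mono) auto
        then have "norm (lincomb t u - c *\<^sub>R (\<Sum>n\<in>r ` F. y n)) < 1 / (real (\<tau> (Suc (2 * k))) + 1)"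
          using close unfolding sum_r by linarith
        then have "\<exists>\<phi>. cutoff (\<tau> (2 * k)) (\<tau> (Suc (2 * k))) \<phi> \<and>
            norm (lincomb t (\<lambda>i. \<phi> i * u i) - c *\<^sub>R (\<Sum>n\<in>r ` F \<inter> {..<\<tau> (2 * k)}. y n)) < (1/2) ^ (2 * k)"
          using \<tau>G[of "2 * k"] u c F gap unfolding G_def by blast
        then show ?thesis unfolding below sum_r by (simp add: True)
      next
        case False
        \<comment> \<open>Beyond \<open>N\<close> no term of \<open>F\<close> has to be isolated; a
          cutoff is still needed there because \<open>splitting\<close> concerns all
          \<open>k\<close>.\<close>
        have "\<tau> (2 * k) \<le> \<tau> (2 * k + 1)" using strict_mono_less_eq[OF \<tau>] by simp
        from cutoff_indicator[OF this] False show ?thesis by blast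
      qed
      then obtain \<phi> where \<phi>: "\<And>k. cutoff (\<tau> (2 * k)) (\<tau> (2 * k + 1)) (\<phi> k)"
        "\<And>k. k \<le> N \<Longrightarrow> norm (lincomb t (\<lambda>i. \<phi> k i * u i) - c *\<^sub>R (\<Sum>j\<in>F \<inter> {..<k}. y (r j))) < (1/2) ^ (2 * k)"
        by metis
      have "norm (lincomb t (\<lambda>i. (\<phi> (Suc k) i - \<phi> k i) * u i) - c *\<^sub>R y (r k)) \<le> 2 * (1/2) ^ k" if k: "k \<in> F" for k
      proof -
        have kN: "Suc k \<le> N" "k \<le> N" using N k by auto
        have "F \<inter> {..<Suc k} = insert k (F \<inter> {..<k})" using k by auto
        then have S: "(\<Sum>j\<in>F \<inter> {..<Suc k}. y (r j)) = y (r k) + (\<Sum>j\<in>F \<inter> {..<k}. y (r j))"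
          using F by simp
        have fs: "finitely_supported (\<lambda>i. \<phi> j i * u i)" for j using u(1) by (rule finitely_supported_mult)
        have "lincomb t (\<lambda>i. (\<phi> (Suc k) i - \<phi> k i) * u i) =
            lincomb t (\<lambda>i. \<phi> (Suc k) i * u i) - lincomb t (\<lambda>i. \<phi> k i * u i)"
          using lincomb_diff[OF fs fs, of t "Suc k" k] by (simp add: left_diff_distrib)
        then have "lincomb t (\<lambda>i. (\<phi> (Suc k) i - \<phi> k i) * u i) - c *\<^sub>R y (r k) =
            (lincomb t (\<lambda>i. \<phi> (Suc k) i * u i) - c *\<^sub>R (\<Sum>j\<in>F \<inter> {..<Suc k}. y (r j))) -
            (lincomb t (\<lambda>i. \<phi> k i * u i) - c *\<^sub>R (\<Sum>j\<in>F \<inter> {..<k}. y (r j)))"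
          unfolding S by (simp add: algebra_simps)
        then have "norm (lincomb t (\<lambda>i. (\<phi> (Suc k) i - \<phi> k i) * u i) - c *\<^sub>R y (r k))
            \<le> (1/2) ^ (2 * Suc k) + (1/2) ^ (2 * k)"
          using norm_triangle_ineq4 \<phi>(2)[OF kN(1)] \<phi>(2)[OF kN(2)] by (smt (verit))
        also have "\<dots> \<le> (1/2) ^ k + (1/2) ^ k" by (intro add_mono power_decreasing) auto
        finally show ?thesis by simp
      qed
      with splitting_cutoff_differences[OF \<tau> \<phi>(1)] show ?thesis
        by (intro exI[of _ "\<lambda>k i. \<phi> (Suc k) i - \<phi> k i"]) simp
    qed
    \<comment> \<open>This is the smallest of the tolerances demanded by the even gaps with
      \<open>k \<le> N\<close>.\<close>
    then show ?thesis by (intro exI[of _ "1 / (real (\<tau> (2 * N + 1)) + 1)"]) auto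
  qed
  then have "split_lifts R (y \<circ> r)" unfolding split_lifts_def o_apply by blast
  with r show thesis by (rule that)
qed

text \<open>A lift \<open>u\<close> of a long normalized sum has few large coordinates, and each of them meets at most
  two summands. Dropping those summands hardly changes the sum, since its coefficient is small.\<close>

lemma flat_lift:
  assumes split: "split_lifts M y"
    and normed: "\<And>k. norm (y k) = 1"
    and unbounded: "\<And>K B. \<exists>F. finite F \<and> F \<subseteq> {K..} \<and> B < norm (\<Sum>k\<in>F. y k)"
    and "\<delta> > 0" "e > 0"
  obtains F c u where "finite F" "F \<subseteq> {K..}" "c > 0" "finitely_supported u" "schreier_norm u \<le> M"
    "\<forall>i. \<bar>u i\<bar> \<le> \<delta>" "norm (c *\<^sub>R (\<Sum>k\<in>F. y k) - lincomb t u) \<le> e" "1/2 \<le> norm (c *\<^sub>R (\<Sum>k\<in>F. y k))"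
proof -
  \<comment> \<open>The pieces with indices from \<open>K'\<close> on have total error at most
    \<open>4 * (1/2) ^ K'\<close>, which is to be at most \<open>e\<close>.\<close>
  obtain k0 where k0: "(1/2 :: real) ^ k0 < e / 4" using real_arch_pow_inv[of "e / 4" "1/2"] \<open>e > 0\<close> by auto
  define K' where "K' = max K k0"
  have "(1/2 :: real) ^ K' \<le> (1/2) ^ k0" by (intro power_decreasing) (auto simp: K'_def)
  with k0 have K': "4 * (1/2 :: real) ^ K' \<le> e" by linarith
  obtain m :: nat where "M / \<delta> < real m" using reals_Archimedean2 by blast
  then have m: "M < real m * \<delta>" using \<open>\<delta> > 0\<close> by (simp add: pos_divide_less_eq)
  \<comment> \<open>The threshold gives \<open>c \<le> 1\<close>, and it keeps the cost of dropping
    up to \<open>4 * m\<close> unit vectors, each with coefficient \<open>c\<close>, at most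
    \<open>1/2\<close>.\<close>
  obtain F0 where F0: "finite F0" "F0 \<subseteq> {K'..}" "8 * real m + 1 < norm (\<Sum>k\<in>F0. y k)"
    using unbounded by blast
  define c where "c = 1 / norm (\<Sum>k\<in>F0. y k)"
  have c: "0 < c" "c \<le> 1" "4 * real m * c \<le> 1/2"
  proof -
    have "1 < norm (\<Sum>k\<in>F0. y k)" "8 * real m \<le> norm (\<Sum>k\<in>F0. y k)"
      using F0(3) of_nat_0_le_iff[of m] by linarith+
    then show "0 < c" "c \<le> 1" "4 * real m * c \<le> 1/2" unfolding c_def by (auto simp: divide_le_eq)
  qed
  have unit: "norm (c *\<^sub>R (\<Sum>k\<in>F0. y k)) = 1" using c(1) unfolding c_def by simp
  obtain \<eta> where \<eta>: "\<eta> > 0" "\<forall>u c. finitely_supported u \<longrightarrow> schreier_norm u \<le> M \<longrightarrow>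
      0 \<le> c \<longrightarrow> c \<le> 1 \<longrightarrow> norm (lincomb t u - c *\<^sub>R (\<Sum>k\<in>F0. y k)) < \<eta> \<longrightarrow>
      (\<exists>\<psi>. splitting \<psi> \<and> (\<forall>k\<in>F0. norm (lincomb t (\<lambda>i. \<psi> k i * u i) - c *\<^sub>R y k) \<le> 2 * (1/2) ^ k))"
    using split F0(1) unfolding split_lifts_def by blast
  obtain u where u: "finitely_supported u" "schreier_norm u \<le> M"
    "norm (lincomb t u - c *\<^sub>R (\<Sum>k\<in>F0. y k)) < \<eta>"
    using lift[OF \<eta>(1), of "c *\<^sub>R (\<Sum>k\<in>F0. y k)"] unfolding unit by auto
  obtain \<psi> where \<psi>: "splitting \<psi>"
    "\<And>k. k \<in> F0 \<Longrightarrow> norm (lincomb t (\<lambda>i. \<psi> k i * u i) - c *\<^sub>R y k) \<le> 2 * (1/2) ^ k"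
    using \<eta>(2) u c by (meson less_imp_le)
  have \<psi>0: "0 \<le> \<psi> k i" and \<psi>1: "finite G \<Longrightarrow> (\<Sum>k\<in>G. \<psi> k i) \<le> 1" for k i G
    using \<psi>(1) by (auto simp: splitting_def)
  obtain l where l: "\<And>i k. \<psi> k i \<noteq> 0 \<Longrightarrow> k = l i \<or> k = Suc (l i)"
    using \<psi>(1) unfolding splitting_def by metis
  define G where "G = {i. \<delta> < \<bar>u i\<bar>}"
  have G: "finite G" "card G \<le> 2 * m"
    unfolding G_def using card_large_coordinates_le[OF u(1,2) \<open>\<delta> > 0\<close> m] by auto
  \<comment> \<open>The summands touched by a large coordinate: at most two for each of at most
    \<open>2 * m\<close> coordinates.\<close>
  define D where "D = {k \<in> F0. \<exists>i\<in>G. \<psi> k i \<noteq> 0}"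
  have "D \<subseteq> (\<Union>i\<in>G. {l i, Suc (l i)})" using l by (auto simp: D_def)
  then have "card D \<le> card (\<Union>i\<in>G. {l i, Suc (l i)})" using G(1) by (intro card_mono) auto
  also have "\<dots> \<le> (\<Sum>i\<in>G. card {l i, Suc (l i)})" using G(1) by (rule card_UN_le)
  also have "\<dots> = 2 * card G" by simp
  finally have card_D: "card D \<le> 4 * m" using G(2) by linarith
  define F where "F = F0 - D"
  define w where "w = (\<lambda>i. \<Sum>k\<in>F. \<psi> k i * u i)"
  have F: "finite F" "F \<subseteq> F0" using F0(1) by (auto simp: F_def)
  have w_eq: "w i = (\<Sum>k\<in>F. \<psi> k i) * u i" for i by (simp add: w_def sum_distrib_right)
  have w_le: "\<bar>w i\<bar> \<le> \<bar>u i\<bar>" for i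
    unfolding w_eq abs_mult using \<psi>0 \<psi>1[OF F(1)] by (intro mult_left_le_one_le) (auto simp: sum_nonneg abs_le_iff)
  have "norm (c *\<^sub>R (\<Sum>k\<in>F. y k) - lincomb t w) \<le> e"
  proof -
    have "lincomb t w = (\<Sum>k\<in>F. lincomb t (\<lambda>i. \<psi> k i * u i))"
      unfolding w_def using F(1) u(1) by (intro lincomb_sum finitely_supported_mult)
    then have "c *\<^sub>R (\<Sum>k\<in>F. y k) - lincomb t w = (\<Sum>k\<in>F. c *\<^sub>R y k - lincomb t (\<lambda>i. \<psi> k i * u i))"
      by (simp add: sum_subtractf scaleR_sum_right)
    also have "norm \<dots> \<le> (\<Sum>k\<in>F. 2 * (1/2) ^ k)"
      using \<psi>(2) F(2) by (intro sum_norm_le) (auto simp: norm_minus_commute)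
    also have "\<dots> = 2 * (\<Sum>k\<in>F. (1/2) ^ k)" by (simp add: sum_distrib_left)
    also have "\<dots> \<le> 2 * (2 * (1/2) ^ K')" using F F0(2) by (intro mult_left_mono sum_half_powers_le) auto
    finally show ?thesis using K' by linarith
  qed
  moreover have "1/2 \<le> norm (c *\<^sub>R (\<Sum>k\<in>F. y k))"
  proof -
    have "(\<Sum>k\<in>F0. y k) = (\<Sum>k\<in>F. y k) + (\<Sum>k\<in>D. y k)"
      unfolding F_def using F0(1) by (intro sum.subset_diff) (auto simp: D_def)
    then have "1 \<le> norm (c *\<^sub>R (\<Sum>k\<in>F. y k)) + norm (c *\<^sub>R (\<Sum>k\<in>D. y k))"
      using unit norm_triangle_ineq[of "c *\<^sub>R (\<Sum>k\<in>F. y k)" "c *\<^sub>R (\<Sum>k\<in>D. y k)"]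
      by (simp add: scaleR_right_distrib)
    moreover have "norm (c *\<^sub>R (\<Sum>k\<in>D. y k)) \<le> 1/2"
    proof -
      have "norm (\<Sum>k\<in>D. y k) \<le> real (card D)" using norm_sum[of y D] normed by simp
      then have "norm (c *\<^sub>R (\<Sum>k\<in>D. y k)) \<le> c * real (card D)" using c(1) by simp
      also have "\<dots> \<le> c * (4 * real m)" using card_D c(1) by (intro mult_left_mono) linarith+
      finally show ?thesis using c(3) by (simp add: mult_ac)
    qed
    ultimately show ?thesis by linarith
  qed
  \<comment> \<open>At a large coordinate all retained weights vanish; elsewhere \<open>w\<close> is
    dominated by \<open>u\<close>.\<close>
  moreover have "\<bar>w i\<bar> \<le> \<delta>" for i
  proof (cases "i \<in> G")
    case True
    then have "\<psi> k i = 0" if "k \<in> F" for k using that by (auto simp: F_def D_def)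
    then show ?thesis using \<open>\<delta> > 0\<close> by (simp add: w_def)
  next
    case False
    then show ?thesis using w_le[of i] by (simp add: G_def)
  qed
  moreover have "finitely_supported w" using u(1) by (rule finitely_supported_mono) (simp add: w_eq)
  moreover have "schreier_norm w \<le> M" using schreier_norm_mono[OF u(1) w_le] u(2) by linarith
  moreover have "F \<subseteq> {K..}" using F(2) F0(2) by (auto simp: K'_def)
  ultimately show thesis using that[of F c w] F(1) c(1) by blast
qed


text \<open>In each application of \<open>flat_lift\<close> the flatness is chosen after the support
  bound of the preceding lift is known, so the lifts meet the hypotheses of
  \<open>schreier_c0_estimate\<close>. The approximation errors are summable and do not destroy the
  upper estimate.\<close>

lemma unbounded_sums_c0_blocks:
  assumes split: "split_lifts M y"
    and normed: "\<And>k. norm (y k) = 1"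
    and unbounded: "\<And>K B. \<exists>F. finite F \<and> F \<subseteq> {K..} \<and> B < norm (\<Sum>k\<in>F. y k)"
  obtains v where "block_basis_of_1_averages y v" "equivalent_to_c0_basis v"
proof -
  define P where "P = (\<lambda>n (F, c, u, q :: nat). finite F \<and> F \<noteq> {} \<and> c > 0 \<and> finitely_supported u \<and>
    schreier_norm u \<le> M \<and> (\<forall>i\<ge>q. u i = 0) \<and> norm (c *\<^sub>R (\<Sum>k\<in>F. y k) - lincomb t u) \<le> (1/2) ^ n \<and>
    1/2 \<le> norm (c *\<^sub>R (\<Sum>k\<in>F. y k)))"
  define Q where "Q = (\<lambda>n (F :: nat set, c :: real, u :: nat \<Rightarrow> real, q :: nat)
    (F' :: nat set, c' :: real, u' :: nat \<Rightarrow> real, q' :: nat).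
    Max F < Min F' \<and> q \<le> q' \<and> (\<forall>i. \<bar>u' i\<bar> * real q \<le> (1/2) ^ Suc n))"
  have step: "\<exists>F c u q. P n (F, c, u, q) \<and> (\<forall>k\<in>F. K \<le> k) \<and> q0 \<le> q \<and> (\<forall>i. \<bar>u i\<bar> * real q0 \<le> (1/2) ^ n)"
    for n K q0
  proof -
    have "(1/2) ^ n / (real q0 + 1) > 0" "(1/2 :: real) ^ n > 0" by simp_all
    then obtain F c u where *: "finite F" "F \<subseteq> {K..}" "c > 0" "finitely_supported u" "schreier_norm u \<le> M"
      "\<forall>i. \<bar>u i\<bar> \<le> (1/2) ^ n / (real q0 + 1)" "norm (c *\<^sub>R (\<Sum>k\<in>F. y k) - lincomb t u) \<le> (1/2) ^ n"
      "1/2 \<le> norm (c *\<^sub>R (\<Sum>k\<in>F. y k))"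
      using flat_lift[OF split normed unbounded] by metis
    obtain q where q: "\<And>i. q \<le> i \<Longrightarrow> u i = 0" using *(4) by (rule finitely_supportedE) blast
    have "\<bar>u i\<bar> * real q0 \<le> (1/2) ^ n" for i
    proof -
      have "\<bar>u i\<bar> * real q0 \<le> \<bar>u i\<bar> * (real q0 + 1)" by (intro mult_left_mono) auto
      also have "\<dots> \<le> (1/2) ^ n" using *(6) by (intro iffD1[OF pos_le_divide_eq]) auto
      finally show ?thesis .
    qed
    moreover have "F \<noteq> {}" using *(8) by auto
    ultimately show ?thesis using * q
      by (intro exI[of _ F] exI[of _ c] exI[of _ u] exI[of _ "max q q0"]) (auto simp: P_def)
  qed
  have "\<exists>f. \<forall>n. P n (f n) \<and> Q n (f n) (f (Suc n))"
  proof (rule dependent_nat_choice)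
    show "\<exists>s. P 0 s" using step[of 0 0 0] by blast
    fix s n assume Ps: "P n s"
    obtain F c u q where s: "s = (F, c, u, q)" by (cases s) auto
    obtain F' c' u' q' where *: "P (Suc n) (F', c', u', q')" "\<forall>k\<in>F'. Suc (Max F) \<le> k" "q \<le> q'"
      "\<forall>i. \<bar>u' i\<bar> * real q \<le> (1/2) ^ Suc n" using step[of "Suc n" "Suc (Max F)" q] by blast
    have "finite F'" "F' \<noteq> {}" using *(1) by (auto simp: P_def)
    then have "Max F < Min F'" using *(2) Min_in by (metis Suc_le_eq)
    with * show "\<exists>s'. P (Suc n) s' \<and> Q n s s'"
      unfolding s by (intro exI[of _ "(F', c', u', q')"] conjI) (simp_all only: Q_def prod.case, blast)
  qed
  then obtain f where f: "\<And>n. P n (f n)" "\<And>n. Q n (f n) (f (Suc n))" by blast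
  define F where "F = (\<lambda>n. fst (f n))"
  define c where "c = (\<lambda>n. fst (snd (f n)))"
  define u where "u = (\<lambda>n. fst (snd (snd (f n))))"
  define q where "q = (\<lambda>n. snd (snd (snd (f n))))"
  have f_eq: "f n = (F n, c n, u n, q n)" for n by (simp add: F_def c_def u_def q_def)
  have Pn: "finite (F n) \<and> F n \<noteq> {} \<and> c n > 0 \<and> finitely_supported (u n) \<and>
      schreier_norm (u n) \<le> M \<and> (\<forall>i\<ge>q n. u n i = 0) \<and>
      norm (c n *\<^sub>R (\<Sum>k\<in>F n. y k) - lincomb t (u n)) \<le> (1/2) ^ n \<and>
      1/2 \<le> norm (c n *\<^sub>R (\<Sum>k\<in>F n. y k))" for n
    using f(1)[of n] unfolding f_eq P_def prod.case .
  have Qn: "Max (F n) < Min (F (Suc n)) \<and> q n \<le> q (Suc n) \<and> (\<forall>i. \<bar>u (Suc n) i\<bar> * real (q n) \<le> (1/2) ^ Suc n)" for n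
    using f(2)[of n] unfolding f_eq Q_def prod.case .
  have F: "c n > 0 \<and> finite (F n) \<and> F n \<noteq> {} \<and> Max (F n) < Min (F (Suc n))" for n
    using Pn[of n] Qn[of n] by blast
  have u: "finitely_supported (u n)" "schreier_norm (u n) \<le> M" "q n \<le> i \<Longrightarrow> u n i = 0" for n i
    using Pn[of n] by simp_all
  have q: "q n \<le> q (Suc n)" "\<bar>u (Suc n) i\<bar> * real (q n) \<le> (1/2) ^ Suc n" for n i
    using Qn[of n] by simp_all
  have v: "norm (c n *\<^sub>R (\<Sum>k\<in>F n. y k) - lincomb t (u n)) \<le> (1/2) ^ n"
    "1/2 \<le> norm (c n *\<^sub>R (\<Sum>k\<in>F n. y k))" for n
    using Pn[of n] by blast+
  define v where "v = (\<lambda>n. c n *\<^sub>R (\<Sum>k\<in>F n. y k))"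
  have block: "block_basis_of_1_averages y v"
    unfolding block_basis_of_1_averages_def v_def using F by blast
  have flat: "\<bar>u k i\<bar> * real (q j) \<le> (1/2) ^ k" if "j < k" for j k i
  proof -
    obtain k' where k: "k = Suc k'" "j \<le> k'" using \<open>j < k\<close> by (cases k) auto
    have "q j \<le> q k'" using q(1) k(2) by (rule lift_Suc_mono_le)
    then have "\<bar>u k i\<bar> * real (q j) \<le> \<bar>u k i\<bar> * real (q k')" by (intro mult_left_mono) auto
    also have "\<dots> \<le> (1/2) ^ k" using q(2)[of k' i] k by simp
    finally show ?thesis .
  qed
  \<comment> \<open>The lifts contribute \<open>C * (M + 2)\<close>, their approximation errors at
    most 2.\<close>
  have upper: "norm (\<Sum>k\<le>n. a k *\<^sub>R v k) \<le> C * (M + 2) + 2"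
    if a: "\<And>k. k \<le> n \<Longrightarrow> \<bar>a k\<bar> \<le> 1" for a :: "nat \<Rightarrow> real" and n
  proof -
    let ?w = "\<lambda>i. \<Sum>k\<le>n. a k * u k i"
    have fs: "finitely_supported ?w" using u(1) by (intro finitely_supported_sum finitely_supported_mult) auto
    have L: "lincomb t ?w = (\<Sum>k\<le>n. a k *\<^sub>R lincomb t (u k))"
      using lincomb_sum[of "{..n}" "\<lambda>k i. a k * u k i" t] u(1)
      by (simp add: finitely_supported_mult lincomb_scale)
    have "norm (lincomb t ?w) \<le> C * schreier_norm ?w" by (rule C[OF fs])
    also have "\<dots> \<le> C * (M + 2)"
      using C_pos u a flat by (intro mult_left_mono schreier_c0_estimate[where q = q]) auto
    finally have 1: "norm (lincomb t ?w) \<le> C * (M + 2)" .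
    have "norm (\<Sum>k\<le>n. a k *\<^sub>R (v k - lincomb t (u k))) \<le> (\<Sum>k\<le>n. (1/2) ^ k)"
    proof (rule sum_norm_le)
      fix k assume "k \<in> {..n}"
      then have "\<bar>a k\<bar> * norm (v k - lincomb t (u k)) \<le> 1 * norm (v k - lincomb t (u k))"
        using a by (intro mult_right_mono) auto
      then show "norm (a k *\<^sub>R (v k - lincomb t (u k))) \<le> (1/2) ^ k"
        using v(1)[of k] by (simp add: v_def)
    qed
    also have "\<dots> \<le> 2" using sum_half_powers_le[of "{..n}" 0] by simp
    finally have 2: "norm (\<Sum>k\<le>n. a k *\<^sub>R (v k - lincomb t (u k))) \<le> 2" .
    have "(\<Sum>k\<le>n. a k *\<^sub>R v k) = lincomb t ?w + (\<Sum>k\<le>n. a k *\<^sub>R (v k - lincomb t (u k)))"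
      unfolding L by (simp add: sum.distrib[symmetric] scaleR_diff_right)
    with norm_triangle_mono[OF 1 2] show ?thesis by (simp only:)
  qed
  have low: "1/2 \<le> norm (v n)" for n using v(2) by (simp add: v_def)
  obtain s where "strict_mono s" "equivalent_to_c0_basis (v \<circ> s)"
    using upper_c0_imp_c0_subsequence[of v "C * (M + 2) + 2" "1/2"] upper low by auto
  then show thesis using that block_basis_of_1_averages_comp[OF block] by blast
qed

text \<open>For a functional norming a combination, splitting the indices by the sign of
  \<open>f (v k)\<close> bounds the sum of \<open>\<bar>f (v k)\<bar>\<close> by
  \<open>2 * B\<close>. Thus a tail of \<open>y\<close> has an upper estimate, and singletons with
  coefficient 1 serve as averages.\<close>

lemma bounded_sums_c0_blocks:
  fixes y :: "nat \<Rightarrow> 'b"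
  assumes normed: "\<And>k. norm (y k) = 1"
    and bounded: "\<And>F. finite F \<Longrightarrow> F \<subseteq> {K..} \<Longrightarrow> norm (\<Sum>k\<in>F. y k) \<le> B"
  obtains v where "block_basis_of_1_averages y v" "equivalent_to_c0_basis v"
proof -
  define v where "v = y \<circ> (\<lambda>n. K + n)"
  have "block_basis_of_1_averages y y"
    unfolding block_basis_of_1_averages_def by (intro exI[of _ "\<lambda>_. 1"] exI[of _ "\<lambda>k. {k}"]) simp
  then have block: "block_basis_of_1_averages y v"
    unfolding v_def by (rule block_basis_of_1_averages_comp) (simp add: strict_mono_def)
  have bounded': "norm (\<Sum>k\<in>A. v k) \<le> B" if A: "finite A" for A
  proof -
    have "(\<Sum>k\<in>A. v k) = (\<Sum>k\<in>(\<lambda>n. K + n) ` A. y k)" by (subst sum.reindex) (auto simp: v_def)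
    moreover have "(\<lambda>n. K + n) ` A \<subseteq> {K..}" by auto
    ultimately show ?thesis using bounded[of "(\<lambda>n. K + n) ` A"] A by simp
  qed
  have upper: "norm (\<Sum>k\<le>n. a k *\<^sub>R v k) \<le> 2 * B"
    if a: "\<And>k. k \<le> n \<Longrightarrow> \<bar>a k\<bar> \<le> 1" for a :: "nat \<Rightarrow> real" and n
  proof -
    obtain f :: "'b \<Rightarrow> real" where f: "bounded_linear f" "\<And>y. \<bar>f y\<bar> \<le> norm y"
      "f (\<Sum>k\<le>n. a k *\<^sub>R v k) = norm (\<Sum>k\<le>n. a k *\<^sub>R v k)"
      using norming_functional[of "\<Sum>k\<le>n. a k *\<^sub>R v k"] by blast
    interpret f: bounded_linear f by fact
    let ?P = "{k. k \<le> n \<and> 0 \<le> f (v k)}" and ?N = "{k. k \<le> n \<and> f (v k) < 0}"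
    have "norm (\<Sum>k\<le>n. a k *\<^sub>R v k) = (\<Sum>k\<le>n. a k * f (v k))"
      using f(3) by (simp add: f.sum f.scaleR)
    also have "\<dots> \<le> (\<Sum>k\<le>n. \<bar>f (v k)\<bar>)"
    proof (rule sum_mono)
      fix k assume "k \<in> {..n}"
      then have "\<bar>a k\<bar> * \<bar>f (v k)\<bar> \<le> 1 * \<bar>f (v k)\<bar>" using a by (intro mult_right_mono) auto
      then show "a k * f (v k) \<le> \<bar>f (v k)\<bar>" by (metis abs_ge_self abs_mult mult_1 order_trans)
    qed
    also have "\<dots> = (\<Sum>k\<in>?P \<union> ?N. \<bar>f (v k)\<bar>)" by (intro sum.cong) auto
    also have "\<dots> = (\<Sum>k\<in>?P. \<bar>f (v k)\<bar>) + (\<Sum>k\<in>?N. \<bar>f (v k)\<bar>)" by (intro sum.union_disjoint) auto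
    also have "(\<Sum>k\<in>?P. \<bar>f (v k)\<bar>) = f (\<Sum>k\<in>?P. v k)" by (simp add: f.sum)
    also have "(\<Sum>k\<in>?N. \<bar>f (v k)\<bar>) = - f (\<Sum>k\<in>?N. v k)" by (simp add: f.sum sum_negf[symmetric])
    also have "f (\<Sum>k\<in>?P. v k) + - f (\<Sum>k\<in>?N. v k) \<le> B + B"
      using f(2)[of "\<Sum>k\<in>?P. v k"] f(2)[of "\<Sum>k\<in>?N. v k"] bounded'[of ?P] bounded'[of ?N] by simp
    finally show ?thesis by simp
  qed
  have low: "1 \<le> norm (v n)" for n using normed by (simp add: v_def)
  obtain s where "strict_mono s" "equivalent_to_c0_basis (v \<circ> s)"
    using upper_c0_imp_c0_subsequence[of v "2 * B" 1] upper low by auto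
  then show thesis using that block_basis_of_1_averages_comp[OF block] by blast
qed

theorem weakly_null_c0_blocks:
  assumes "weakly_null (x :: nat \<Rightarrow> 'b)" "\<And>n. norm (x n) = 1"
  obtains v where "block_basis_of_1_averages x v" "equivalent_to_c0_basis v"
proof -
  obtain r1 :: "nat \<Rightarrow> nat" where r1: "strict_mono r1" "weakly_null_sums (x \<circ> r1)"
    using weakly_null_sums_subsequence[OF assms(1)] by blast
  \<comment> \<open>Radius \<open>M\<close> is enough, because only sums normalized to norm 1 will
    be lifted.\<close>
  obtain r2 :: "nat \<Rightarrow> nat" where r2: "strict_mono r2" "split_lifts M ((x \<circ> r1) \<circ> r2)"
    using splitting_subsequence[OF r1(2), of M] by blast
  define y where "y = x \<circ> (r1 \<circ> r2)"
  have split: "split_lifts M y" using r2(2) by (simp add: y_def o_assoc)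
  have normed: "norm (y k) = 1" for k using assms(2) by (simp add: y_def)
  obtain v where v: "block_basis_of_1_averages y v" "equivalent_to_c0_basis v"
  proof (cases "\<exists>K B. \<forall>F. finite F \<longrightarrow> F \<subseteq> {K..} \<longrightarrow> norm (\<Sum>k\<in>F. y k) \<le> B")
    case True
    then obtain K B where KB: "\<And>F. finite F \<Longrightarrow> F \<subseteq> {K..} \<Longrightarrow> norm (\<Sum>k\<in>F. y k) \<le> B" by blast
    show thesis by (rule bounded_sums_c0_blocks[OF normed KB]) (use that in blast)+
  next
    case False
    then have unb: "\<exists>F. finite F \<and> F \<subseteq> {K..} \<and> B < norm (\<Sum>k\<in>F. y k)" for K B by (meson not_le)
    show thesis by (rule unbounded_sums_c0_blocks[OF split normed unb]) (use that in blast)+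
  qed
  have "strict_mono (r1 \<circ> r2)" using r1(1) r2(1) by (rule strict_mono_o)
  then have "block_basis_of_1_averages x v"
    by (rule block_basis_of_1_averages_subsequence[OF v(1)[unfolded y_def]])
  with v(2) that show thesis by blast
qed

end

subsection \<open>Quotients of the Schreier space\<close>

lemma finitely_supported_in_schreier_space: "finitely_supported u \<Longrightarrow> u \<in> schreier_space"
proof -
  assume u: "finitely_supported u"
  have "schreier_norm (\<lambda>i. u i - u i) \<le> 0" by (rule schreier_norm_leI) simp
  then show ?thesis unfolding schreier_space_def using u finitely_supported_bdd_above[OF u] by force
qed

lemma schreier_space_diff_finitely_supported:
  assumes "x \<in> schreier_space" "finitely_supported u"
  shows "(\<lambda>i. x i - u i) \<in> schreier_space"
proof -
  have "bdd_above {(\<Sum>i\<in>F. \<bar>x i - u i\<bar>) | F. schreier_admissible F}"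
  proof (rule bdd_aboveI)
    fix s assume "s \<in> {(\<Sum>i\<in>F. \<bar>x i - u i\<bar>) | F. schreier_admissible F}"
    then obtain F where F: "schreier_admissible F" "s = (\<Sum>i\<in>F. \<bar>x i - u i\<bar>)" by blast
    have "s \<le> (\<Sum>i\<in>F. \<bar>x i\<bar>) + (\<Sum>i\<in>F. \<bar>u i\<bar>)"
      unfolding F(2) sum.distrib[symmetric] by (intro sum_mono) auto
    moreover have "(\<Sum>i\<in>F. \<bar>x i\<bar>) \<le> schreier_norm x"
      using assms(1) F(1) unfolding schreier_space_def by (intro schreier_norm_upper) auto
    ultimately show "s \<le> schreier_norm x + schreier_norm u"
      using schreier_sum_le_norm[OF assms(2) F(1)] by linarith
  qed
  moreover have "\<exists>y. finitely_supported y \<and> schreier_norm (\<lambda>i. x i - u i - y i) < e" if "e > 0" for e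
  proof -
    obtain y where y: "finitely_supported y" "schreier_norm (\<lambda>i. x i - y i) < e"
      using assms(1) \<open>e > 0\<close> unfolding schreier_space_def by blast
    have "finitely_supported (\<lambda>i. y i + - 1 * u i)"
      by (intro finitely_supported_add y finitely_supported_mult assms)
    then show ?thesis using y(2) by (intro exI[of _ "\<lambda>i. y i - u i"]) simp
  qed
  ultimately show ?thesis unfolding schreier_space_def by blast
qed

text \<open>The images of the balls with integer radii have closures that cover the range, so by
  Baire one closure contains a ball. Symmetrizing moves this ball to the origin, and scaling gives
  the uniform constant \<open>M\<close>.\<close>

lemma schreier_quotient_map_dense_range:
  fixes T :: "(nat \<Rightarrow> real) \<Rightarrow> 'b::banach"
  assumes T: "schreier_quotient_map T"
  obtains C M where "schreier_dense_range (\<lambda>i. T (\<lambda>j. if j = i then 1 else 0)) C M"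
proof -
  define t where "t = (\<lambda>i. T (\<lambda>j. if j = i then 1 else 0))"
  have lin: "T (\<lambda>i. a * x i + b * y i) = a *\<^sub>R T x + b *\<^sub>R T y"
    if "x \<in> schreier_space" "y \<in> schreier_space" for x y a b
    using T that unfolding schreier_quotient_map_def by blast
  obtain C0 where C0: "\<And>x. x \<in> schreier_space \<Longrightarrow> norm (T x) \<le> C0 * schreier_norm x"
    using T unfolding schreier_quotient_map_def by blast
  have surj: "\<exists>x\<in>schreier_space. T x = y" for y
    using T unfolding schreier_quotient_map_def by (metis UNIV_I image_iff)
  have T_sum: "T (\<lambda>j. if j \<in> A then u j else 0) = (\<Sum>i\<in>A. u i *\<^sub>R t i)" if "finite A" for A u
    using that
  proof (induction rule: finite_induct)
    case empty
    have "(\<lambda>_. 0) \<in> schreier_space"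
      by (intro finitely_supported_in_schreier_space) (simp add: finitely_supported_def)
    from lin[OF this this, of 0 0] show ?case by simp
  next
    case (insert x A)
    have "(\<lambda>j. if j \<in> A then u j else 0) \<in> schreier_space" "(\<lambda>j. if j = x then 1 else 0) \<in> schreier_space"
      using insert(1) by (auto intro!: finitely_supported_in_schreier_space simp: finitely_supported_def)
    from lin[OF this, of 1 "u x"] insert
    have "T (\<lambda>i. 1 * (if i \<in> A then u i else 0) + u x * (if i = x then 1 else 0)) =
        (\<Sum>i\<in>insert x A. u i *\<^sub>R t i)" by (simp add: t_def)
    moreover have "(\<lambda>i. 1 * (if i \<in> A then u i else 0) + u x * (if i = x then 1 else 0)) =
        (\<lambda>j. if j \<in> insert x A then u j else 0)" using insert(2) by auto
    ultimately show ?case by simp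
  qed
  have T_lincomb: "T u = lincomb t u" if "finitely_supported u" for u
  proof -
    have "(\<lambda>j. if j \<in> {i. u i \<noteq> 0} then u j else 0) = u" by auto
    then show ?thesis using T_sum[of "{i. u i \<noteq> 0}" u] that by (simp add: lincomb_def finitely_supported_def)
  qed
  define C where "C = max C0 1"
  have C: "norm (lincomb t u) \<le> C * schreier_norm u" if "finitely_supported u" for u
  proof -
    have "norm (lincomb t u) \<le> C0 * schreier_norm u"
      using C0 finitely_supported_in_schreier_space T_lincomb that by metis
    also have "\<dots> \<le> C * schreier_norm u"
      using schreier_norm_nonneg[OF that] by (intro mult_right_mono) (auto simp: C_def)
    finally show ?thesis .
  qed
  have approx: "\<exists>u. finitely_supported u \<and> schreier_norm u \<le> schreier_norm x + 1 \<and> norm (lincomb t u - T x) < e"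
    if x: "x \<in> schreier_space" and e: "e > 0" for x e
  proof -
    \<comment> \<open>The bound 1 controls the norm of the approximant, \<open>e / C\<close> the
      error of its image.\<close>
    have "min 1 (e / C) > 0" using e by (simp add: C_def)
    then obtain u where u: "finitely_supported u" "schreier_norm (\<lambda>i. x i - u i) < min 1 (e / C)"
      using x unfolding schreier_space_def by blast
    have xu: "(\<lambda>i. x i - u i) \<in> schreier_space" by (rule schreier_space_diff_finitely_supported[OF x u(1)])
    have ge: "(\<Sum>i\<in>F. \<bar>z i\<bar>) \<le> schreier_norm z" if "z \<in> schreier_space" "schreier_admissible F" for z F
      using that unfolding schreier_space_def by (intro schreier_norm_upper) auto
    have n0: "0 \<le> schreier_norm (\<lambda>i. x i - u i)"
      using ge[OF xu schreier_admissible_singleton[of 0]] by (simp add: order_trans[OF abs_ge_zero])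
    have "schreier_norm u \<le> schreier_norm x + 1"
    proof (rule schreier_norm_leI)
      fix F assume F: "schreier_admissible F"
      have "(\<Sum>i\<in>F. \<bar>u i\<bar>) \<le> (\<Sum>i\<in>F. \<bar>x i\<bar>) + (\<Sum>i\<in>F. \<bar>x i - u i\<bar>)"
        unfolding sum.distrib[symmetric] by (intro sum_mono) auto
      then show "(\<Sum>i\<in>F. \<bar>u i\<bar>) \<le> schreier_norm x + 1" using ge[OF x F] ge[OF xu F] u(2) by simp
    qed
    moreover have "norm (lincomb t u - T x) < e"
    proof -
      have "T (\<lambda>i. x i - u i) = T x - lincomb t u"
        using lin[OF x finitely_supported_in_schreier_space[OF u(1)], of 1 "- 1"] T_lincomb[OF u(1)] by simp
      then have "norm (lincomb t u - T x) \<le> C0 * schreier_norm (\<lambda>i. x i - u i)"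
        using C0[OF xu] by (simp add: norm_minus_commute)
      also have "\<dots> \<le> C * schreier_norm (\<lambda>i. x i - u i)" using n0 by (intro mult_right_mono) (auto simp: C_def)
      also have "\<dots> < e"
      proof -
        have "C > 0" by (simp add: C_def)
        then show ?thesis using u(2) by (simp add: pos_less_divide_eq mult.commute)
      qed
      finally show ?thesis .
    qed
    ultimately show ?thesis using u(1) by blast
  qed
  define A where "A = (\<lambda>n :: nat. {lincomb t u | u. finitely_supported u \<and> schreier_norm u \<le> real n})"
  have cover: "\<exists>n. y \<in> closure (A n)" for y
  proof -
    obtain x where x: "x \<in> schreier_space" "T x = y" using surj by blast
    obtain n :: nat where n: "schreier_norm x + 1 < real n" using reals_Archimedean2 by blast
    have "y \<in> closure (A n)" unfolding closure_approachable
    proof (intro allI impI)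
      fix e :: real assume "e > 0"
      then obtain u where u: "finitely_supported u" "schreier_norm u \<le> schreier_norm x + 1"
        "norm (lincomb t u - T x) < e" using approx[OF x(1)] by blast
      then show "\<exists>a\<in>A n. dist a y < e"
        using n x(2) by (intro bexI[of _ "lincomb t u"]) (auto simp: A_def dist_norm)
    qed
    then show ?thesis by blast
  qed
  have "\<exists>n. interior (closure (A n)) \<noteq> {}"
  proof (rule ccontr)
    assume "\<not> ?thesis"
    then have "euclidean interior_of \<Union> (range (\<lambda>n. closure (A n))) = ({} :: 'b set)"
      by (intro Baire_category_alt disjI1 completely_metrizable_space_euclidean) auto
    moreover have "\<Union> (range (\<lambda>n. closure (A n))) = UNIV" using cover by auto
    ultimately show False by simp
  qed
  then obtain n y0 where "y0 \<in> interior (closure (A n))" by blast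
  then obtain r where r: "r > 0" "ball y0 r \<subseteq> closure (A n)" using mem_interior by blast
  have small: "\<exists>u. finitely_supported u \<and> schreier_norm u \<le> real n \<and> norm (lincomb t u - z) < e"
    if z: "norm z < r" and e: "e > 0" for z e
  proof -
    have "y0 + z \<in> closure (A n)" "y0 - z \<in> closure (A n)" using z r(2) by (auto simp: dist_norm)
    then obtain u1 u2 where u1: "finitely_supported u1" "schreier_norm u1 \<le> real n" "norm (lincomb t u1 - (y0 + z)) < e"
      and u2: "finitely_supported u2" "schreier_norm u2 \<le> real n" "norm (lincomb t u2 - (y0 - z)) < e"
      using e unfolding closure_approachable A_def dist_norm by blast
    \<comment> \<open>Half the difference of lifts of \<open>y0 + z\<close> and
      \<open>y0 - z\<close> lifts \<open>z\<close> without leaving the ball of radius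
      \<open>n\<close>.\<close>
    let ?u = "\<lambda>i. (1/2) * u1 i + (- 1/2) * u2 i"
    have fs: "finitely_supported ?u" by (intro finitely_supported_add finitely_supported_mult u1 u2)
    have "schreier_norm ?u \<le> schreier_norm (\<lambda>i. (1/2) * u1 i) + schreier_norm (\<lambda>i. (- 1/2) * u2 i)"
      by (intro schreier_norm_add_le finitely_supported_mult u1 u2)
    also have "\<dots> \<le> real n"
      using schreier_norm_scale_le[OF u1(1), of "1/2"] schreier_norm_scale_le[OF u2(1), of "- 1/2"] u1(2) u2(2) by simp
    finally have "schreier_norm ?u \<le> real n" .
    moreover have "lincomb t ?u = (1/2) *\<^sub>R lincomb t u1 + (- 1/2) *\<^sub>R lincomb t u2"
      using lincomb_scale[OF u1(1), of t "1/2"] lincomb_scale[OF u2(1), of t "- 1/2"]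
        lincomb_add[OF finitely_supported_mult[OF u1(1), of "\<lambda>_. 1/2"]
          finitely_supported_mult[OF u2(1), of "\<lambda>_. - 1/2"], of t] by simp
    then have "lincomb t ?u - z = (1/2) *\<^sub>R (lincomb t u1 - (y0 + z)) - (1/2) *\<^sub>R (lincomb t u2 - (y0 - z))"
      by (simp add: algebra_simps scaleR_2[symmetric] flip: scaleR_left_distrib)
    then have "norm (lincomb t ?u - z) < e"
      using norm_triangle_ineq4[of "(1/2) *\<^sub>R (lincomb t u1 - (y0 + z))" "(1/2) *\<^sub>R (lincomb t u2 - (y0 - z))"]
        u1(3) u2(3) by simp
    ultimately show ?thesis using fs by blast
  qed
  \<comment> \<open>Dividing \<open>y\<close> by \<open>2 * norm y / r\<close> puts it at norm
    \<open>r / 2\<close>, inside the ball; the summand 1 keeps \<open>M\<close> positive when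
    \<open>n = 0\<close>.\<close>
  define M where "M = 2 * real n / r + 1"
  have "\<exists>u. finitely_supported u \<and> schreier_norm u \<le> M * norm y \<and> norm (lincomb t u - y) < e" if e: "e > 0" for y e
  proof (cases "y = 0")
    case True
    have "schreier_norm (\<lambda>_. 0) \<le> 0" by (rule schreier_norm_leI) simp
    then show ?thesis using True e by (intro exI[of _ "\<lambda>_. 0"]) (simp add: finitely_supported_def lincomb_def)
  next
    case False
    define s where "s = 2 * norm y / r"
    have s: "s > 0" using False r(1) by (simp add: s_def)
    have "norm ((1 / s) *\<^sub>R y) < r" using False r(1) by (simp add: s_def)
    moreover have "e / s > 0" using e s by simp
    ultimately obtain u where u: "finitely_supported u" "schreier_norm u \<le> real n"
      "norm (lincomb t u - (1 / s) *\<^sub>R y) < e / s" using small by blast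
    have "schreier_norm (\<lambda>i. s * u i) \<le> s * real n"
      using schreier_norm_scale_le[OF u(1), of s] s mult_left_mono[OF u(2), of s] by linarith
    also have "\<dots> \<le> M * norm y" by (simp add: s_def M_def algebra_simps)
    finally have "schreier_norm (\<lambda>i. s * u i) \<le> M * norm y" .
    moreover have "norm (lincomb t (\<lambda>i. s * u i) - y) < e"
    proof -
      have "lincomb t (\<lambda>i. s * u i) - y = s *\<^sub>R (lincomb t u - (1 / s) *\<^sub>R y)"
        using s lincomb_scale[OF u(1), of t s] by (simp add: scaleR_diff_right)
      then show ?thesis using u(3) s by (simp add: pos_less_divide_eq mult.commute)
    qed
    ultimately show ?thesis using finitely_supported_mult[OF u(1), of "\<lambda>_. s"] by blast
  qed
  then have "schreier_dense_range t C M"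
    using C r(1) by unfold_locales (auto simp: C_def M_def add_nonneg_pos)
  then show thesis using that unfolding t_def by blast
qed

theorem mainTheorem3:
  fixes T :: "(nat \<Rightarrow> real) \<Rightarrow> 'b::banach"
  assumes "schreier_quotient_map T"
  shows "\<forall>x :: nat \<Rightarrow> 'b. (\<forall>n. norm (x n) = 1) \<and> weakly_null x \<longrightarrow>
           (\<exists>y. block_basis_of_1_averages x y \<and> equivalent_to_c0_basis y)"
proof (intro allI impI)
  fix x :: "nat \<Rightarrow> 'b" assume x: "(\<forall>n. norm (x n) = 1) \<and> weakly_null x"
  obtain C M where "schreier_dense_range (\<lambda>i. T (\<lambda>j. if j = i then 1 else 0)) C M"
    using assms by (rule schreier_quotient_map_dense_range)
  then interpret schreier_dense_range "\<lambda>i. T (\<lambda>j. if j = i then 1 else 0)" C M .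
  show "\<exists>y. block_basis_of_1_averages x y \<and> equivalent_to_c0_basis y"
    by (rule weakly_null_c0_blocks[OF conjunct2[OF x] conjunct1[OF x, rule_format]]) blast
qed

end
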